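(* Let the number of time steps $T\ge2$ be fixed. Assume that $\min_{\sigma\in\mathfrak{S}_Q}\|\hat\pi^{1:T}_\sigma-\pi^{*1:T}\|_\infty=o_{\mathbb{P}_{\theta^*}}(v_n)$ with $\{v_n\}_{n\ge1}$ a sequence decreasing to $0$ such that $v_n=o(\sqrt{\log(n)}/n)$. Then for any $\epsilon>0$ and any sequence $\{r_n\}_{n\ge1}$ increasing to infinity such that $r_n=o\left(\sqrt{n/\log n}\right)$, $$\mathbb{P}_{\theta^*}\left(\min_{\sigma\in\mathfrak{S}_Q}\|\hat\Gamma_\sigma-\Gamma^*\|_\infty>\epsilon\, r_n\frac{\sqrt{\log n}}{\sqrt n}\right)\xrightarrow[n\to\infty]{}0 .$$ Here $\hat\theta=(\hat\Gamma,\hat\pi^{1:T})$ is the maximum likelihood estimator, in the sense specified in the context.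
   Context: Notation: $[M]=\{1,\dots,M\}$. Fix the number of classes $Q\ge 2$ and constants $0<\delta<1/Q$, $0<\zeta<1/2$. Model (fixed $T$, time-varying connectivity). There are $n$ nodes observed at times $t=1,\dots,T$. The latent labels $Z_i=(Z_i^1,\dots,Z_i^T)$, $i\in[n]$, are i.i.d. homogeneous stationary Markov chains on $[Q]$ with transition matrix $\Gamma=(\gamma_{ql})_{q,l\in[Q]}$, started from its stationary distribution $\alpha$. Write $Z^t=(Z_1^t,\dots,Z_n^t)$, $Z^{1:T}=(Z^1,\dots,Z^T)$. The observations $X^{1:T}=(X^1,\dots,X^T)$ are symmetric binary adjacency matrices $X^t=(X^t_{ij})_{i,j\in[n]}$ with $X^t_{ii}=0$; conditionally on $Z^{1:T}$, the $X^t_{ij}$ ($i<j$, $t\in[T]$) are independent and $X^t_{ij}$ is Bernoulli with parameter $\pi^t_{Z^t_iZ^t_j}$, where $\pi^{1:T}=(\pi^1,\dots,\pi^T)$ and each $\pi^t=(\pi^t_{ql})$ is a symmetric $Q\times Q$ matrix. The parameter is $\theta=(\Gamma,\pi^{1:T})$ and $\mathbb{P}_\theta$ is the law of all variables under $\theta$. $\Theta^T$ is the set of $\theta=(\Gamma,\pi^{1:T})$ (with $\Gamma$ stochastic, $\pi^t$ symmetric) such that: for every $t$ and all $q\ne q'$ there is $l$ with $\pi^t_{ql}\ne\pi^t_{q'l}$; $\gamma_{ql}\in[\delta,1-\delta]$ for all $q,l$; $\pi^t_{ql}\in[\zeta,1-\zeta]$ for all $t,q,l$; and for every $q$ the value $\pi^t_{qq}=:\pi_{qq}$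 does not depend on $t$, with $\{\pi_{qq}:q\in[Q]\}$ being $Q$ distinct values. The true parameter is $\theta^*=(\Gamma^*,\pi^{*1:T})\in\Theta^T$. $\mathfrak{S}_Q$ is the set of permutations of $[Q]$; $\pi^{1:T}_\sigma=(\pi^t_\sigma)_t$ with $\pi^t_\sigma=(\pi^t_{\sigma(q)\sigma(l)})_{q,l}$; $\Gamma_\sigma=(\gamma_{\sigma(q)\sigma(l)})_{q,l}$; $\|\pi^{1:T}-\pi'^{1:T}\|_\infty=\max_{q,l,t}|\pi^t_{ql}-\pi'^t_{ql}|$, $\|\Gamma-\Gamma'\|_\infty=\max_{q,l}|\gamma_{ql}-\gamma'_{ql}|$. $Y_n=o_{\mathbb{P}_{\theta^*}}(v_n)$ means $Y_n/v_n\to0$ in $\mathbb{P}_{\theta^*}$-probability. Maximum likelihood estimator. Let $\hat\theta=(\hat\Gamma,\hat\pi^{1:T})=\operatorname{argmax}_{\theta\in\Theta^T}\log\mathbb{P}_\theta(X^{1:T})$. Consider, for $\theta=(\Gamma,\pi^{1:T})$, the fixed-point equation $$\gamma_{ql}=\frac{\sum_{t=1}^{T-1}\sum_{i=1}^n\mathbb{P}_\theta(Z_i^t=q,Z_i^{t+1}=l\mid X^{1:T})}{\sum_{t=1}^{T-1}\sum_{i=1}^n\mathbb{P}_\theta(Z_i^t=q\mid X^{1:T})}\quad\text{for all }(q,l)\in[Q]^2 .\qquad(\ast)$$ If $\hat\theta$ satisfies $(\ast)$ it is kept as is. Otherwise it is assumed that (at least for $n$ large enough) there exists $\breve\Gamma$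 such that $(\breve\Gamma,\hat\pi^{1:T})\in\Theta^T$ satisfies $(\ast)$, and $\hat\Gamma$ is replaced by $\breve\Gamma$; the resulting estimator is still denoted $\hat\theta=(\hat\Gamma,\hat\pi^{1:T})$. Thus in all cases $\hat\theta\in\Theta^T$ satisfies $(\ast)$ (for $n$ large enough). A sequence increasing to infinity (decreasing to $0$) is a positive sequence tending to $+\infty$ (to $0$) as $n\to\infty$. *)

theory Defs
  imports "HOL-Probability.Probability" "HOL-Library.Landau_Symbols"
begin

text \<open>The set of classes is a finite type \<open>'q\<close>, so that \<open>Q\<close> is \<open>CARD('q)\<close>. A parameter is a pair
  of a transition matrix and a family of connectivity matrices indexed by time; only the times in
  \<open>{1..T}\<close> matter. Nodes are numbered \<open>1..n\<close>.\<close>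

type_synonym 'q param = "(real^'q^'q) \<times> (nat \<Rightarrow> real^'q^'q)"

text \<open>Labels are indexed by node, then time; adjacency matrices by time, then the two nodes.\<close>

type_synonym 'q labels = "nat \<Rightarrow> nat \<Rightarrow> 'q"
type_synonym graphs = "nat \<Rightarrow> nat \<Rightarrow> nat \<Rightarrow> bool"

definition row_pmf :: "real^'q::finite^'q \<Rightarrow> 'q \<Rightarrow> 'q pmf" where
  "row_pmf \<Gamma> q = embed_pmf (\<lambda>l. \<Gamma> $ q $ l)"

text \<open>The description is proper since all entries of \<open>\<Gamma>\<close> are positive for the parameters considered,
  which makes the stationary distribution unique.\<close>

definition stationary_pmf :: "real^'q::finite^'q \<Rightarrow> 'q pmf" where
  "stationary_pmf \<Gamma> = (THE \<alpha>. bind_pmf \<alpha> (row_pmf \<Gamma>) = \<alpha>)"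

text \<open>Law of \<open>(Z\<^sup>1, \<dots>, Z\<^sup>T)\<close> for one node; times outside \<open>{1..T}\<close> carry a dummy value.\<close>

fun chain_pmf :: "real^'q::finite^'q \<Rightarrow> nat \<Rightarrow> (nat \<Rightarrow> 'q) pmf" where
  "chain_pmf \<Gamma> 0 = return_pmf (\<lambda>_. undefined)"
| "chain_pmf \<Gamma> (Suc t) =
     bind_pmf (chain_pmf \<Gamma> t) (\<lambda>z.
       map_pmf (\<lambda>l. z(Suc t := l))
         (if t = 0 then stationary_pmf \<Gamma> else row_pmf \<Gamma> (z t)))"

definition labels_pmf :: "nat \<Rightarrow> nat \<Rightarrow> real^'q::finite^'q \<Rightarrow> 'q labels pmf" where
  "labels_pmf n T \<Gamma> = Pi_pmf {1..n} (\<lambda>_. undefined) (\<lambda>_. chain_pmf \<Gamma> T)"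

text \<open>The edge indicators are drawn for \<open>i < j\<close> and then symmetrised. Diagonal entries and entries
  outside the range of the indices take the default value \<open>False\<close>.\<close>

definition graphs_pmf ::
    "nat \<Rightarrow> nat \<Rightarrow> (nat \<Rightarrow> real^'q::finite^'q) \<Rightarrow> 'q labels \<Rightarrow> graphs pmf" where
  "graphs_pmf n T \<pi> z =
     map_pmf (\<lambda>e t i j. e (t, min i j, max i j))
       (Pi_pmf {(t, i, j). t \<in> {1..T} \<and> 1 \<le> i \<and> i < j \<and> j \<le> n} False
         (\<lambda>(t, i, j). bernoulli_pmf (\<pi> t $ z i t $ z j t)))"

definition model_pmf :: "nat \<Rightarrow> nat \<Rightarrow> 'q::finite param \<Rightarrow> ('q labels \<times> graphs) pmf" where
  "model_pmf n T \<theta> =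
     bind_pmf (labels_pmf n T (fst \<theta>)) (\<lambda>z. map_pmf (Pair z) (graphs_pmf n T (snd \<theta>) z))"

definition Theta :: "real \<Rightarrow> real \<Rightarrow> nat \<Rightarrow> 'q::finite param set" where
  "Theta \<delta> \<zeta> T = {(\<Gamma>, \<pi>).
     (\<forall>q. (\<Sum>l\<in>UNIV. \<Gamma> $ q $ l) = 1) \<and>
     (\<forall>t\<in>{1..T}. transpose (\<pi> t) = \<pi> t) \<and>
     (\<forall>t\<in>{1..T}. \<forall>q q'. q \<noteq> q' \<longrightarrow> (\<exists>l. \<pi> t $ q $ l \<noteq> \<pi> t $ q' $ l)) \<and>
     (\<forall>q l. \<Gamma> $ q $ l \<in> {\<delta>..1 - \<delta>}) \<and>
     (\<forall>t\<in>{1..T}. \<forall>q l. \<pi> t $ q $ l \<in> {\<zeta>..1 - \<zeta>}) \<and>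
     (\<forall>s\<in>{1..T}. \<forall>t\<in>{1..T}. \<forall>q. \<pi> s $ q $ q = \<pi> t $ q $ q) \<and>
     (\<forall>t\<in>{1..T}. inj (\<lambda>q. \<pi> t $ q $ q))}"

definition permute_mat :: "('q \<Rightarrow> 'q) \<Rightarrow> real^'q::finite^'q \<Rightarrow> real^'q^'q" where
  "permute_mat \<sigma> A = (\<chi> q l. A $ \<sigma> q $ \<sigma> l)"

definition dist_Gamma :: "real^'q::finite^'q \<Rightarrow> real^'q^'q \<Rightarrow> real" where
  "dist_Gamma \<Gamma> \<Gamma>' = (MAX (q, l)\<in>UNIV. \<bar>\<Gamma> $ q $ l - \<Gamma>' $ q $ l\<bar>)"

definition dist_pi ::
    "nat \<Rightarrow> (nat \<Rightarrow> real^'q::finite^'q) \<Rightarrow> (nat \<Rightarrow> real^'q^'q) \<Rightarrow> real" where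
  "dist_pi T \<pi> \<pi>' = (MAX (q, l, t)\<in>UNIV \<times> UNIV \<times> {1..T}. \<bar>\<pi> t $ q $ l - \<pi>' t $ q $ l\<bar>)"

definition log_likelihood :: "nat \<Rightarrow> nat \<Rightarrow> graphs \<Rightarrow> 'q::finite param \<Rightarrow> real" where
  "log_likelihood n T x \<theta> = ln (\<P>(\<omega> in model_pmf n T \<theta>. snd \<omega> = x))"

definition fixed_point :: "nat \<Rightarrow> nat \<Rightarrow> graphs \<Rightarrow> 'q::finite param \<Rightarrow> bool" where
  "fixed_point n T x \<theta> \<longleftrightarrow> (\<forall>q l. fst \<theta> $ q $ l =
     (\<Sum>t\<in>{1..T - 1}. \<Sum>i\<in>{1..n}.
        \<P>(\<omega> in model_pmf n T \<theta>. fst \<omega> i t = q \<and> fst \<omega> i (t + 1) = l \<bar> snd \<omega> = x)) /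
     (\<Sum>t\<in>{1..T - 1}. \<Sum>i\<in>{1..n}.
        \<P>(\<omega> in model_pmf n T \<theta>. fst \<omega> i t = q \<bar> snd \<omega> = x)))"

text \<open>\<open>\<theta>\<close> is a value of the estimator at the observation \<open>x\<close>: a maximiser \<open>(\<Gamma>\<^sub>0, \<pi>)\<close> of the likelihood
  over the parameter set, whose first component is replaced if (and only if) the maximiser does not
  satisfy the fixed-point equation. For some \<open>x\<close> (such as complete graphs) there is no such value, as
  \<open>Theta\<close> is not closed, so this can be required only with probability tending to 1.\<close>

definition is_mle ::
    "real \<Rightarrow> real \<Rightarrow> nat \<Rightarrow> nat \<Rightarrow> graphs \<Rightarrow> 'q::finite param \<Rightarrow> bool" where
  "is_mle \<delta> \<zeta> n T x \<theta> \<longleftrightarrow> (\<exists>\<Gamma>\<^sub>0.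
     is_arg_max (log_likelihood n T x) (\<lambda>\<theta>'. \<theta>' \<in> Theta \<delta> \<zeta> T) (\<Gamma>\<^sub>0, snd \<theta>) \<and>
     (if fixed_point n T x (\<Gamma>\<^sub>0, snd \<theta>) then fst \<theta> = \<Gamma>\<^sub>0
      else \<theta> \<in> Theta \<delta> \<zeta> T \<and> fixed_point n T x \<theta>))"

text \<open>\<open>Y\<^sub>n = o\<^sub>P(v\<^sub>n)\<close>, where the underlying probability space may vary with \<open>n\<close>.\<close>

definition small_o_prob ::
    "(nat \<Rightarrow> 'a measure) \<Rightarrow> (nat \<Rightarrow> 'a \<Rightarrow> real) \<Rightarrow> (nat \<Rightarrow> real) \<Rightarrow> bool" where
  "small_o_prob M Y v \<longleftrightarrow>
     (\<forall>\<epsilon>>0. (\<lambda>n. \<P>(\<omega> in M n. \<bar>Y n \<omega> / v n\<bar> > \<epsilon>)) \<longlonglongrightarrow> 0)"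

end

theory Submission
  imports Defs "HOL-Real_Asymp.Real_Asymp"
begin

text \<open>If the labels were observed, the transition matrix would be estimated by empirical transition
  frequencies, with an error of order \<open>1 / \<surd>n\<close>: the transition counts minus \<open>\<gamma>\<^sub>q\<^sub>l\<close> times the visit
  counts are sums over independent nodes of bounded centred variables, and every class is visited
  a number of times of order \<open>n\<close> (\<open>transition_deviation\<close>, \<open>balanced_prob\<close>). Since \<open>r\<^sub>n \<surd>(log n)\<close>
  tends to infinity, an error of the claimed size is then unlikely.

  The fixed-point equation expresses the estimate by the same frequencies, with label indicators
  replaced by posterior probabilities (\<open>fixed_point_error\<close>). So it remains to see that the posterior
  under the estimated parameter is nearly a point mass at the true labels, up to the permutation that
  aligns the estimated connection matrices with the true ones.

  For a labelling \<open>z\<close> that is wrong at \<open>d\<close> nodes, the distinct diagonal values and distinct rows of the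
  connection matrices force a number of edges of order \<open>n d\<close> to have a different connection probability
  under \<open>z\<close> and under the truth, provided all classes are large (\<open>informative_edges\<close>). The posterior
  mass of \<open>z\<close> is at most the square root of its posterior odds against the truth, and under the true
  law the expectation of the root of the likelihood ratio is a product of Bhattacharyya coefficients,
  hence exponentially small in \<open>n d\<close> (\<open>expectation_root_ratio\<close>). This beats the prior, which costs a
  constant factor per wrong node, and the number of labellings, and it also beats the replacement of the
  true connection matrices by any matrices within a small fixed distance, which costs at most a small
  exponential factor (\<open>posterior_bound\<close>). Therefore one random sum dominates the posterior errors of all
  parameters near the truth simultaneously, and Markov's inequality makes it at most \<open>1 / n\<close> with high
  probability (\<open>posterior_concentration\<close>). Uniformity takes care of the dependence of the estimator on
  the data; consistency of the estimated connection matrices places the estimator near the truth.\<close>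

section \<open>Markov chains with positive transition matrices\<close>

lemma pmf_bind_finite:
  fixes p :: "'a::finite pmf"
  shows "pmf (bind_pmf p f) x = (\<Sum>a\<in>UNIV. pmf p a * pmf (f a) x)"
  unfolding pmf_bind by (subst integral_measure_pmf_real[of UNIV]) (auto simp: mult.commute)

lemma pmf_bind_ge: "pmf p a * pmf (f a) x \<le> pmf (bind_pmf p f) x"
proof -
  have "pmf p a * pmf (f a) x = measure_pmf.expectation p (\<lambda>b. indicator {a} b * pmf (f a) x)"
    by (simp add: measure_pmf_single)
  also have "\<dots> \<le> measure_pmf.expectation p (\<lambda>b. pmf (f b) x)"
    by (intro integral_mono measure_pmf.integrable_const_bound[where B = 1])
      (auto simp: indicator_def pmf_le_1)
  finally show ?thesis by (simp add: pmf_bind)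
qed

lemma pmf_bind_Pair:
  "pmf (bind_pmf p (\<lambda>a. map_pmf (Pair a) (f a))) (a, b) = pmf p a * pmf (f a) b"
proof -
  have "pmf (map_pmf (Pair c) (f c)) (a, b) = indicator {a} c * pmf (f a) b" for c
  proof (cases "c = a")
    case True
    then show ?thesis using pmf_map_inj'[of "Pair a" "f a" b] by (simp add: inj_def)
  next
    case False
    then show ?thesis by (auto simp: pmf_map vimage_def)
  qed
  then show ?thesis by (simp add: pmf_bind measure_pmf_single)
qed

text \<open>Outside \<open>{1..T}\<close> a trajectory carries the default value of the model.\<close>

definition paths :: "nat \<Rightarrow> (nat \<Rightarrow> 'q) set" where
  "paths T = {1..T} \<rightarrow>\<^sub>E UNIV"

lemma finite_paths: "finite (paths T :: (nat \<Rightarrow> 'q::finite) set)"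
  unfolding paths_def by (intro finite_PiE) auto

lemma set_chain_pmf: "set_pmf (chain_pmf \<Gamma> T) \<subseteq> paths T"
proof (induction T)
  case (Suc T)
  then show ?case by (fastforce simp: paths_def PiE_iff extensional_def)
qed (auto simp: paths_def)

text \<open>The parameter set guarantees a uniform lower bound on the transition probabilities. It yields a
  unique stationary law, so that the description in the model is proper, and lower bounds on the
  probability of every class and of every trajectory.\<close>

locale positive_chain =
  fixes \<Gamma> :: "real^'q::finite^'q" and \<delta> :: real
  assumes row_sum: "(\<Sum>l\<in>UNIV. \<Gamma> $ q $ l) = 1"
    and entry_ge: "\<delta> \<le> \<Gamma> $ q $ l"
    and delta_pos: "0 < \<delta>"
begin

lemma entry_nonneg: "0 \<le> \<Gamma> $ q $ l"
  using entry_ge[of q l] delta_pos by linarith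

lemma pmf_row: "pmf (row_pmf \<Gamma> q) l = \<Gamma> $ q $ l"
  unfolding row_pmf_def
proof (rule pmf_embed_pmf)
  show "(\<integral>\<^sup>+ x. ennreal (\<Gamma> $ q $ x) \<partial>count_space UNIV) = 1"
    by (simp add: nn_integral_count_space_finite sum_ennreal entry_nonneg row_sum)
qed (rule entry_nonneg)

text \<open>Doeblin's argument: the difference of two stationary laws has total mass zero, so \<open>\<delta>\<close> may be
  subtracted from every entry of \<open>\<Gamma>\<close> without changing its image; the reduced matrix contracts the
  \<open>l\<^sup>1\<close>-norm.\<close>

lemma stationary_unique:
  assumes "bind_pmf \<alpha> (row_pmf \<Gamma>) = \<alpha>" "bind_pmf \<beta> (row_pmf \<Gamma>) = \<beta>"
  shows "\<alpha> = \<beta>"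
proof -
  define d where "d q = pmf \<alpha> q - pmf \<beta> q" for q
  have sum_d: "(\<Sum>q\<in>UNIV. d q) = 0"
    unfolding d_def sum_subtractf by (simp add: sum_pmf_eq_1)
  have d_step: "d l = (\<Sum>q\<in>UNIV. d q * (\<Gamma> $ q $ l - \<delta>))" for l
  proof -
    have "d l = (\<Sum>q\<in>UNIV. d q * \<Gamma> $ q $ l)"
      using pmf_bind_finite[of \<alpha> "row_pmf \<Gamma>" l] pmf_bind_finite[of \<beta> "row_pmf \<Gamma>" l]
      by (simp add: assms d_def pmf_row left_diff_distrib sum_subtractf)
    also have "\<dots> = (\<Sum>q\<in>UNIV. d q * (\<Gamma> $ q $ l - \<delta>)) + (\<Sum>q\<in>UNIV. d q) * \<delta>"
      by (simp add: right_diff_distrib sum_subtractf sum_distrib_right)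
    finally show ?thesis by (simp add: sum_d)
  qed
  have "(\<Sum>l\<in>UNIV. \<bar>d l\<bar>) \<le> (\<Sum>l\<in>UNIV. \<Sum>q\<in>UNIV. \<bar>d q\<bar> * (\<Gamma> $ q $ l - \<delta>))"
  proof (rule sum_mono)
    fix l
    have "\<bar>d l\<bar> \<le> (\<Sum>q\<in>UNIV. \<bar>d q * (\<Gamma> $ q $ l - \<delta>)\<bar>)"
      by (subst d_step) (rule sum_abs)
    then show "\<bar>d l\<bar> \<le> (\<Sum>q\<in>UNIV. \<bar>d q\<bar> * (\<Gamma> $ q $ l - \<delta>))"
      by (simp add: abs_mult entry_ge)
  qed
  also have "\<dots> = (\<Sum>q\<in>UNIV. \<bar>d q\<bar> * (1 - real CARD('q) * \<delta>))"
    by (subst sum.swap) (simp add: sum_distrib_left[symmetric] sum_subtractf row_sum)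
  also have "\<dots> = (\<Sum>q\<in>UNIV. \<bar>d q\<bar>) * (1 - real CARD('q) * \<delta>)"
    by (simp add: sum_distrib_right)
  finally have "(\<Sum>l\<in>UNIV. \<bar>d l\<bar>) * (real CARD('q) * \<delta>) \<le> 0"
    by (simp add: algebra_simps)
  then have "(\<Sum>l\<in>UNIV. \<bar>d l\<bar>) \<le> 0"
    using delta_pos by (simp add: mult_le_0_iff not_le)
  then have "\<forall>l. \<bar>d l\<bar> = 0"
    by (metis (mono_tags, lifting) abs_ge_zero sum_nonneg sum_nonneg_eq_0_iff order_antisym finite UNIV_I)
  then show ?thesis by (intro pmf_eqI) (simp add: d_def)
qed

text \<open>Brouwer's theorem on the probability simplex.\<close>

lemma stationary_exists: "\<exists>\<alpha>. bind_pmf \<alpha> (row_pmf \<Gamma>) = \<alpha>"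
proof -
  define S where "S = {v :: real^'q. (\<forall>q. 0 \<le> v $ q) \<and> (\<Sum>q\<in>UNIV. v $ q) = 1}"
  define f where "f v = (\<chi> l. \<Sum>q\<in>UNIV. v $ q * \<Gamma> $ q $ l)" for v :: "real^'q"
  have S_eq: "S = (\<Inter>q. {v. 0 \<le> v $ q}) \<inter> {v. (\<Sum>q\<in>UNIV. v $ q) = 1}"
    by (auto simp: S_def)
  have "closed S"
    unfolding S_eq
    by (intro closed_Int closed_INT ballI closed_Collect_le closed_Collect_eq continuous_intros)
  moreover have "bounded S"
    unfolding bounded_iff
  proof (intro exI ballI)
    fix v assume v: "v \<in> S"
    have "norm v \<le> (\<Sum>q\<in>UNIV. \<bar>v $ q\<bar>)" by (rule norm_le_l1_cart)
    also have "\<dots> = 1" using v by (simp add: S_def)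
    finally show "norm v \<le> 1" .
  qed
  ultimately have "compact S" by (simp add: compact_eq_bounded_closed)
  moreover have "convex S"
  proof (rule convexI)
    fix v w and a b :: real
    assume "v \<in> S" "w \<in> S" "0 \<le> a" "0 \<le> b" "a + b = 1"
    then show "a *\<^sub>R v + b *\<^sub>R w \<in> S"
      by (simp add: S_def sum.distrib sum_distrib_left[symmetric])
  qed
  moreover have "S \<noteq> {}"
  proof -
    have "(\<chi> q. 1 / real CARD('q)) \<in> S" by (simp add: S_def)
    then show ?thesis by blast
  qed
  moreover have "continuous_on S f"
    unfolding f_def by (intro continuous_intros)
  moreover have "f \<in> S \<rightarrow> S"
  proof
    fix v assume v: "v \<in> S"
    have "(\<Sum>l\<in>UNIV. f v $ l) = (\<Sum>q\<in>UNIV. v $ q * (\<Sum>l\<in>UNIV. \<Gamma> $ q $ l))"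
      unfolding f_def by (simp add: sum_distrib_left) (rule sum.swap)
    then show "f v \<in> S"
      using v by (auto simp: S_def row_sum f_def entry_nonneg intro!: sum_nonneg)
  qed
  ultimately obtain v where v: "v \<in> S" "f v = v"
    by (rule brouwer)
  define \<alpha> where "\<alpha> = embed_pmf (\<lambda>q. v $ q)"
  have pmf_\<alpha>: "pmf \<alpha> q = v $ q" for q
    unfolding \<alpha>_def
  proof (rule pmf_embed_pmf)
    show "(\<integral>\<^sup>+ x. ennreal (v $ x) \<partial>count_space UNIV) = 1"
      using v(1) by (simp add: S_def nn_integral_count_space_finite sum_ennreal)
  qed (use v(1) in \<open>simp add: S_def\<close>)
  have "bind_pmf \<alpha> (row_pmf \<Gamma>) = \<alpha>"
  proof (rule pmf_eqI)
    fix l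
    show "pmf (bind_pmf \<alpha> (row_pmf \<Gamma>)) l = pmf \<alpha> l"
      using arg_cong[OF v(2), of "\<lambda>w. w $ l"]
      by (simp add: pmf_bind_finite pmf_row pmf_\<alpha> f_def)
  qed
  then show ?thesis by blast
qed

lemma stationary: "bind_pmf (stationary_pmf \<Gamma>) (row_pmf \<Gamma>) = stationary_pmf \<Gamma>"
  unfolding stationary_pmf_def
  using stationary_exists stationary_unique by (rule_tac theI') blast

lemma stationary_ge: "\<delta> \<le> pmf (stationary_pmf \<Gamma>) l"
proof -
  have "\<delta> = (\<Sum>q\<in>UNIV. pmf (stationary_pmf \<Gamma>) q) * \<delta>"
    by (simp add: sum_pmf_eq_1)
  also have "\<dots> \<le> (\<Sum>q\<in>UNIV. pmf (stationary_pmf \<Gamma>) q * \<Gamma> $ q $ l)"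
    unfolding sum_distrib_right by (intro sum_mono mult_left_mono entry_ge) simp
  also have "\<dots> = pmf (stationary_pmf \<Gamma>) l"
    using pmf_bind_finite[of "stationary_pmf \<Gamma>" "row_pmf \<Gamma>" l] by (simp add: stationary pmf_row)
  finally show ?thesis .
qed

abbreviation step_pmf :: "nat \<Rightarrow> (nat \<Rightarrow> 'q) \<Rightarrow> 'q pmf" where
  "step_pmf t z \<equiv> (if t = 0 then stationary_pmf \<Gamma> else row_pmf \<Gamma> (z t))"

lemma step_ge: "\<delta> \<le> pmf (step_pmf t z) l"
  by (simp add: stationary_ge pmf_row entry_ge)


lemma chain_Suc:
  "chain_pmf \<Gamma> (Suc t) =
     bind_pmf (chain_pmf \<Gamma> t) (\<lambda>z. map_pmf (\<lambda>l. z(Suc t := l)) (step_pmf t z))"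
  by simp

text \<open>Each of the \<open>T\<close> draws picks any given class with probability at least \<open>\<delta>\<close>. So a
  wrong trajectory gains at most a fixed factor from the prior, whereas the edges of a node carry
  information of order \<open>n\<close>.\<close>

lemma chain_pmf_ge:
  "z \<in> paths T \<Longrightarrow> \<delta> ^ T \<le> pmf (chain_pmf \<Gamma> T) z"
proof (induction T arbitrary: z)
  case 0
  then have "z = (\<lambda>_. undefined)" by (auto simp: paths_def)
  then show ?case by simp
next
  case (Suc T)
  define y where "y = z(Suc T := undefined)"
  have y: "y \<in> paths T"
    using Suc.prems by (auto simp: y_def paths_def PiE_iff extensional_def)
  have inj: "inj (\<lambda>l. y(Suc T := l))" by (auto intro!: injI dest: fun_upd_eqD)
  have z: "z = y(Suc T := z (Suc T))" by (simp add: y_def)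
  have "\<delta> ^ Suc T \<le> pmf (chain_pmf \<Gamma> T) y * pmf (step_pmf T y) (z (Suc T))"
    using mult_mono[OF Suc.IH[OF y] step_ge] delta_pos by (simp add: mult.commute)
  also have "pmf (step_pmf T y) (z (Suc T)) = pmf (map_pmf (\<lambda>l. y(Suc T := l)) (step_pmf T y)) z"
    using pmf_map_inj'[OF inj, of "step_pmf T y" "z (Suc T)"] z by simp
  also have "pmf (chain_pmf \<Gamma> T) y * \<dots> \<le> pmf (chain_pmf \<Gamma> (Suc T)) z"
    unfolding chain_Suc by (rule pmf_bind_ge)
  finally show ?case .
qed

lemma map_chain_prefix:
  assumes "s \<le> T" and h: "\<And>z w. (\<And>u. u \<le> s \<Longrightarrow> z u = w u) \<Longrightarrow> h z = h w"
  shows "map_pmf h (chain_pmf \<Gamma> T) = map_pmf h (chain_pmf \<Gamma> s)"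
  using \<open>s \<le> T\<close>
proof (induction T rule: dec_induct)
  case (step t)
  have "h (z(Suc t := l)) = h z" for z l
    using step.hyps by (intro h) auto
  then show ?case
    using step.IH unfolding chain_Suc
    by (simp add: map_bind_pmf pmf.map_comp o_def bind_return_pmf' flip: map_pmf_def)
qed simp

lemma state_prob_ge:
  assumes "t \<in> {1..T}"
  shows "\<delta> \<le> pmf (map_pmf (\<lambda>z. z t) (chain_pmf \<Gamma> T)) q"
proof -
  obtain s where t: "t = Suc s" using assms by (cases t) auto
  have "map_pmf (\<lambda>z. z t) (chain_pmf \<Gamma> T) = map_pmf (\<lambda>z. z t) (chain_pmf \<Gamma> t)"
    using assms by (intro map_chain_prefix) auto
  also have "\<dots> = bind_pmf (chain_pmf \<Gamma> s) (step_pmf s)"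
    unfolding t chain_Suc by (simp add: map_bind_pmf pmf.map_comp o_def pmf.map_ident)
  finally have "pmf (map_pmf (\<lambda>z. z t) (chain_pmf \<Gamma> T)) q =
      measure_pmf.expectation (chain_pmf \<Gamma> s) (\<lambda>z. pmf (step_pmf s z) q)"
    by (simp add: pmf_bind)
  moreover have "\<delta> \<le> measure_pmf.expectation (chain_pmf \<Gamma> s) (\<lambda>z. pmf (step_pmf s z) q)"
    by (intro measure_pmf.integral_ge_const AE_pmfI step_ge
        measure_pmf.integrable_const_bound[where B = 1]) (auto simp: pmf_le_1)
  ultimately show ?thesis by simp
qed

lemma transition_prob:
  assumes "1 \<le> t" "Suc t \<le> T"
  shows "measure_pmf.prob (chain_pmf \<Gamma> T) {z. z t = q \<and> z (Suc t) = l} =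
    \<Gamma> $ q $ l * measure_pmf.prob (chain_pmf \<Gamma> T) {z. z t = q}"
proof -
  define p where "p = map_pmf (\<lambda>z. z t) (chain_pmf \<Gamma> t)"
  have "map_pmf (\<lambda>z. (z t, z (Suc t))) (chain_pmf \<Gamma> T) =
      map_pmf (\<lambda>z. (z t, z (Suc t))) (chain_pmf \<Gamma> (Suc t))"
    using assms by (intro map_chain_prefix) auto
  also have "\<dots> = bind_pmf p (\<lambda>a. map_pmf (Pair a) (row_pmf \<Gamma> a))"
    using assms unfolding p_def chain_Suc
    by (simp add: map_bind_pmf bind_map_pmf pmf.map_comp o_def)
  finally have "pmf (map_pmf (\<lambda>z. (z t, z (Suc t))) (chain_pmf \<Gamma> T)) (q, l) = pmf p q * \<Gamma> $ q $ l"
    by (simp add: pmf_bind_Pair pmf_row)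
  moreover have "p = map_pmf (\<lambda>z. z t) (chain_pmf \<Gamma> T)"
    unfolding p_def using assms by (intro map_chain_prefix[symmetric]) auto
  ultimately show ?thesis
    by (simp add: pmf_map vimage_def)
qed

text \<open>The residual of a transition count against its conditional expectation is centred by the
  Markov property. Summed over times and nodes it is the numerator of the error of the empirical
  transition frequencies.\<close>

lemma expectation_transition_residual:
  assumes "1 \<le> t" "Suc t \<le> T"
  shows "measure_pmf.expectation (chain_pmf \<Gamma> T)
    (\<lambda>z. of_bool (z t = q \<and> z (Suc t) = l) - \<Gamma> $ q $ l * of_bool (z t = q)) = 0"
proof -
  have ind: "measure_pmf.expectation p (\<lambda>z. of_bool (P z)) = measure_pmf.prob p {z. P z}"
    for P and p :: "(nat \<Rightarrow> 'q) pmf"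
  proof -
    have "(\<lambda>z. of_bool (P z) :: real) = indicator {z. P z}"
      by (auto simp: indicator_def)
    then show ?thesis by simp
  qed
  have int: "integrable (measure_pmf p) (\<lambda>z. of_bool (P z) :: real)"
    for P and p :: "(nat \<Rightarrow> 'q) pmf"
    by (intro measure_pmf.integrable_const_bound[where B = 1]) auto
  show ?thesis
    by (simp add: Bochner_Integration.integral_diff int ind transition_prob[OF assms])
qed

end

section \<open>Deviations of sums over independent nodes\<close>

text \<open>Hoeffding's inequality.\<close>

lemma Pi_pmf_sum_deviation:
  fixes f :: "'b \<Rightarrow> real"
  assumes fin: "finite I" and ne: "I \<noteq> {}" and C: "0 < C" and a: "0 \<le> a"
    and f: "\<And>y. y \<in> set_pmf p \<Longrightarrow> \<bar>f y\<bar> \<le> C"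
  shows "measure_pmf.prob (Pi_pmf I dflt (\<lambda>_. p))
      {z. a \<le> \<bar>(\<Sum>i\<in>I. f (z i)) - real (card I) * measure_pmf.expectation p f\<bar>}
    \<le> 2 * exp (- (a\<^sup>2 / (2 * real (card I) * C\<^sup>2)))"
proof -
  let ?M = "Pi_pmf I dflt (\<lambda>_. p)"
  have comp: "map_pmf (\<lambda>z. z i) ?M = p" if "i \<in> I" for i
    using Pi_pmf_component[OF fin, of i dflt "\<lambda>_. p"] that by simp
  have E: "measure_pmf.expectation ?M (\<lambda>z. f (z i)) = measure_pmf.expectation p f"
    if "i \<in> I" for i
    unfolding integral_map_pmf[of "\<lambda>z. z i" ?M f, symmetric] comp[OF that] ..
  have ind: "prob_space.indep_vars ?M (\<lambda>_. borel) (\<lambda>i z. f (z i)) I"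
    by (rule prob_space.indep_vars_compose2[OF measure_pmf.prob_space_axioms
          indep_vars_Pi_pmf[OF fin], where Y = "\<lambda>_. f"]) simp
  interpret Hoeffding_ineq ?M I "\<lambda>i z. f (z i)" "\<lambda>_. -C" "\<lambda>_. C"
    "\<Sum>i\<in>I. measure_pmf.expectation ?M (\<lambda>z. f (z i))"
  proof (unfold_locales)
    show "AE z in ?M. f (z i) \<in> {- C..C}" if i: "i \<in> I" for i
    proof (rule AE_pmfI)
      fix z assume "z \<in> set_pmf ?M"
      then have "z i \<in> set_pmf p"
        using i by (auto simp: set_Pi_pmf[OF fin] PiE_dflt_def)
      from f[OF this] show "f (z i) \<in> {- C..C}" by auto
    qed
  qed (fact fin ind refl)+
  have card: "0 < card I" using fin ne by (simp add: card_gt_0_iff)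
  have "measure_pmf.prob ?M {x \<in> space ?M.
        a \<le> \<bar>(\<Sum>i\<in>I. f (x i)) - (\<Sum>i\<in>I. measure_pmf.expectation ?M (\<lambda>z. f (z i)))\<bar>}
      \<le> 2 * exp (- 2 * a\<^sup>2 / (\<Sum>i\<in>I. (C - - C)\<^sup>2))"
    using C card by (intro Hoeffding_ineq_abs_ge a) simp
  also have "- 2 * a\<^sup>2 / (\<Sum>i\<in>I. (C - - C)\<^sup>2) = - (a\<^sup>2 / (2 * real (card I) * C\<^sup>2))"
    using C card by (simp add: field_simps power2_eq_square)
  finally show ?thesis by (simp add: E)
qed

section \<open>Informative edges of a wrong labelling\<close>

text \<open>Identifiability at a single time. If most members of every class
  keep their label, then a node moved from class \<open>q\<close> to \<open>q'\<close> is exposed by the unmoved members of a class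
  on which the rows \<open>q\<close> and \<open>q'\<close> differ. Otherwise a fixed proportion of some class moves jointly to
  another class, and the pairs inside this group are exposed by the distinct diagonal values; there are
  of order \<open>n\<^sup>2\<close> of them. The second case covers a global permutation of the labels, which therefore
  cannot go unnoticed once the connection matrix is fixed.\<close>

lemma misclassified_pairs:
  fixes A :: "'q::finite \<Rightarrow> 'q \<Rightarrow> 'c" and z w :: "nat \<Rightarrow> 'q" and n :: nat and \<kappa> :: real
  assumes diag: "inj (\<lambda>q. A q q)"
    and rows: "\<And>q q'. q \<noteq> q' \<Longrightarrow> \<exists>l. A q l \<noteq> A q' l"
    and \<kappa>: "0 < \<kappa>" "\<kappa> \<le> 1"
    and classes: "\<And>q. \<kappa> * n \<le> card {i \<in> {1..n}. w i = q}"
  shows "(\<kappa> / (2 * CARD('q)))\<^sup>2 * n * card {i \<in> {1..n}. z i \<noteq> w i}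
    \<le> card {(i, j) \<in> {1..n} \<times> {1..n}. A (z i) (z j) \<noteq> A (w i) (w j)}"
    (is "?c * real n * real (card ?R) \<le> real (card ?D)")
proof -
  have finD: "finite ?D" by (rule finite_subset[of _ "{1..n} \<times> {1..n}"]) auto
  have Q: "1 \<le> real CARD('q)"
    using zero_less_card_finite[where 'a='q] by linarith
  have r_le: "card ?R \<le> n"
    using card_mono[of "{1..n}" ?R] by fastforce
  define N where "N a b = {i \<in> {1..n}. w i = a \<and> z i = b}" for a b
  have finN: "finite (N a b)" for a b by (simp add: N_def)
  show ?thesis
  proof (cases "\<forall>a. \<kappa> * n / 2 \<le> card (N a a)")
    case True
    have "\<forall>i. \<exists>l. z i \<noteq> w i \<longrightarrow> A (z i) l \<noteq> A (w i) l" using rows by metis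
    then obtain l where l: "\<And>i. z i \<noteq> w i \<Longrightarrow> A (z i) (l i) \<noteq> A (w i) (l i)" by metis
    have "?c \<le> \<kappa> / 2"
    proof -
      have "?c \<le> (\<kappa> / 2)\<^sup>2"
        using Q \<kappa> by (intro power_mono divide_left_mono) auto
      also have "\<dots> \<le> \<kappa> / 2" using \<kappa> by (simp add: power2_eq_square field_simps)
      finally show ?thesis .
    qed
    then have "?c * (real n * card ?R) \<le> \<kappa> / 2 * (real n * card ?R)"
      by (intro mult_right_mono) auto
    also have "\<dots> = (\<Sum>i\<in>?R. \<kappa> * n / 2)" by simp
    also have "\<dots> \<le> (\<Sum>i\<in>?R. real (card (N (l i) (l i))))"
      using True by (intro sum_mono) auto
    also have "\<dots> = card (SIGMA i:?R. N (l i) (l i))"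
      by (subst card_SigmaI) (auto simp: finN)
    also have "\<dots> \<le> card ?D"
      using l by (intro of_nat_mono card_mono[OF finD]) (auto simp: N_def)
    finally show ?thesis by (simp add: mult.assoc)
  next
    case False
    then obtain a where a: "card (N a a) < \<kappa> * n / 2" by (auto simp: not_le)
    have "{i \<in> {1..n}. w i = a} = (\<Union>b\<in>UNIV. N a b)" by (auto simp: N_def)
    moreover have "card (\<Union>b\<in>UNIV. N a b) = (\<Sum>b\<in>UNIV. card (N a b))"
      by (intro card_UN_disjoint) (auto simp: N_def)
    ultimately have "\<kappa> * n \<le> (\<Sum>b\<in>UNIV. real (card (N a b)))"
      using classes[of a] by simp
    also have "\<dots> = card (N a a) + (\<Sum>b\<in>UNIV - {a}. real (card (N a b)))"
      by (simp add: sum.remove)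
    finally have *: "\<kappa> * n / 2 < (\<Sum>b\<in>UNIV - {a}. real (card (N a b)))"
      using a by linarith
    have "\<exists>b\<in>UNIV - {a}. \<kappa> * n / (2 * CARD('q)) \<le> card (N a b)"
    proof (rule ccontr)
      assume "\<not> ?thesis"
      then have "(\<Sum>b\<in>UNIV - {a}. real (card (N a b))) \<le> (\<Sum>b\<in>UNIV - {a}. \<kappa> * n / (2 * CARD('q)))"
        by (intro sum_mono) (auto simp: not_le intro: less_imp_le)
      also have "\<dots> \<le> (\<Sum>b\<in>(UNIV :: 'q set). \<kappa> * n / (2 * CARD('q)))"
        using \<kappa> by (intro sum_mono2) auto
      also have "\<dots> = \<kappa> * n / 2" using Q by simp
      finally show False using * by linarith
    qed
    then obtain b where b: "b \<noteq> a" "\<kappa> * n / (2 * CARD('q)) \<le> card (N a b)" by auto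
    have "?c * n * card ?R \<le> ?c * n * n"
      using r_le by (intro mult_left_mono) auto
    also have "\<dots> = (\<kappa> * n / (2 * CARD('q)))\<^sup>2"
      by (simp add: power2_eq_square)
    also have "\<dots> \<le> (real (card (N a b)))\<^sup>2"
      using b \<kappa> by (intro power_mono) auto
    also have "\<dots> = card (N a b \<times> N a b)"
      by (simp add: card_cartesian_product power2_eq_square)
    also have "\<dots> \<le> card ?D"
      using b(1) diag by (intro of_nat_mono card_mono[OF finD]) (auto simp: N_def inj_def)
    finally show ?thesis .
  qed
qed

text \<open>Passing from ordered pairs to edges loses a factor \<open>2\<close> and the diagonal, which has at most one
  exposed entry per error; the latter is absorbed since the number of pairs per error grows with
  \<open>n\<close>.\<close>

lemma misclassified_edges:
  fixes A :: "'q::finite \<Rightarrow> 'q \<Rightarrow> 'c" and z w :: "nat \<Rightarrow> 'q" and n :: nat and \<kappa> :: real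
  assumes sym: "\<And>q l. A q l = A l q"
    and diag: "inj (\<lambda>q. A q q)"
    and rows: "\<And>q q'. q \<noteq> q' \<Longrightarrow> \<exists>l. A q l \<noteq> A q' l"
    and \<kappa>: "0 < \<kappa>" "\<kappa> \<le> 1"
    and classes: "\<And>q. \<kappa> * n \<le> card {i \<in> {1..n}. w i = q}"
    and n: "2 \<le> (\<kappa> / (2 * CARD('q)))\<^sup>2 * n"
  shows "(\<kappa> / (2 * CARD('q)))\<^sup>2 / 4 * n * card {i \<in> {1..n}. z i \<noteq> w i}
    \<le> card {(i, j). 1 \<le> i \<and> i < j \<and> j \<le> n \<and> A (z i) (z j) \<noteq> A (w i) (w j)}"
    (is "?c / 4 * real n * real (card ?R) \<le> real (card ?L)")
proof -
  let ?D = "{(i, j) \<in> {1..n} \<times> {1..n}. A (z i) (z j) \<noteq> A (w i) (w j)}"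
  have fin: "finite ?L" by (rule finite_subset[of _ "{1..n} \<times> {1..n}"]) auto
  have "?D \<subseteq> ?L \<union> prod.swap ` ?L \<union> (\<lambda>i. (i, i)) ` ?R"
  proof
    fix p assume "p \<in> ?D"
    then obtain i j where p: "p = (i, j)" "i \<in> {1..n}" "j \<in> {1..n}" "A (z i) (z j) \<noteq> A (w i) (w j)"
      by auto
    consider "i < j" | "j < i" | "i = j" by linarith
    then show "p \<in> ?L \<union> prod.swap ` ?L \<union> (\<lambda>i. (i, i)) ` ?R"
    proof cases
      case 2
      then have "(j, i) \<in> ?L" using p sym by auto
      then show ?thesis using p(1) by (auto simp: image_iff)
    qed (use p in auto)
  qed
  then have "card ?D \<le> card (?L \<union> prod.swap ` ?L \<union> (\<lambda>i. (i, i)) ` ?R)"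
    by (intro card_mono) (use fin in auto)
  also have "\<dots> \<le> card ?L + card (prod.swap ` ?L) + card ((\<lambda>i. (i, i)) ` ?R)"
    by (rule order_trans[OF card_Un_le]) (simp add: card_Un_le)
  also have "\<dots> \<le> card ?L + card ?L + card ?R"
    by (intro add_mono card_image_le order_refl) (use fin in auto)
  finally have "real (card ?D) \<le> 2 * card ?L + card ?R" by linarith
  moreover have "?c * n * card ?R \<le> card ?D"
    by (rule misclassified_pairs) (fact assms)+
  moreover have "2 * real (card ?R) \<le> ?c * n * card ?R"
    using n by (intro mult_right_mono) auto
  ultimately have "?c * n * card ?R \<le> 4 * real (card ?L)" by linarith
  then show ?thesis by (simp only: mult.commute[of "?c / 4"]) (simp add: field_simps)
qed

definition edges :: "nat \<Rightarrow> nat \<Rightarrow> (nat \<times> nat \<times> nat) set" where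
  "edges n T = {(t, i, j). t \<in> {1..T} \<and> 1 \<le> i \<and> i < j \<and> j \<le> n}"

lemma finite_edges: "finite (edges n T)"
  by (rule finite_subset[of _ "{1..T} \<times> {1..n} \<times> {1..n}"]) (auto simp: edges_def)

text \<open>A node counts as wrong as soon as its label is wrong at one time. Errors are counted by nodes
  since the prior is a product over nodes.\<close>

definition wrong_nodes :: "nat \<Rightarrow> 'q labels \<Rightarrow> 'q labels \<Rightarrow> nat set" where
  "wrong_nodes n z w = {i \<in> {1..n}. z i \<noteq> w i}"

definition balanced :: "real \<Rightarrow> nat \<Rightarrow> nat \<Rightarrow> 'q labels \<Rightarrow> bool" where
  "balanced \<kappa> n T w \<longleftrightarrow> (\<forall>t\<in>{1..T}. \<forall>q. \<kappa> * n \<le> card {i \<in> {1..n}. w i t = q})"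

lemma
  assumes "(\<Gamma>, \<pi>) \<in> Theta \<delta> \<zeta> T"
  shows Theta_row_sum: "\<forall>q. (\<Sum>l\<in>UNIV. \<Gamma> $ q $ l) = 1"
    and Theta_symmetric: "\<forall>t\<in>{1..T}. transpose (\<pi> t) = \<pi> t"
    and Theta_rows: "\<forall>t\<in>{1..T}. \<forall>q q'. q \<noteq> q' \<longrightarrow> (\<exists>l. \<pi> t $ q $ l \<noteq> \<pi> t $ q' $ l)"
    and Theta_Gamma: "\<forall>q l. \<Gamma> $ q $ l \<in> {\<delta>..1 - \<delta>}"
    and Theta_pi: "\<forall>t\<in>{1..T}. \<forall>q l. \<pi> t $ q $ l \<in> {\<zeta>..1 - \<zeta>}"
    and Theta_diagonal: "\<forall>t\<in>{1..T}. inj (\<lambda>q. \<pi> t $ q $ q)"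
  using assms unfolding Theta_def mem_Collect_eq prod.case by - (elim conjE, assumption)+

text \<open>Each wrong node is an error at some time, so the single-time bounds add up to the number of wrong
  nodes.\<close>

lemma informative_edges:
  fixes \<pi> :: "nat \<Rightarrow> real^'q::finite^'q"
  assumes Theta: "(\<Gamma>, \<pi>) \<in> Theta \<delta> \<zeta> T"
    and z: "\<And>i. i \<in> {1..n} \<Longrightarrow> z i \<in> paths T" and w: "\<And>i. i \<in> {1..n} \<Longrightarrow> w i \<in> paths T"
    and \<kappa>: "0 < \<kappa>" "\<kappa> \<le> 1" and bal: "balanced \<kappa> n T w"
    and n: "2 \<le> (\<kappa> / (2 * CARD('q)))\<^sup>2 * n"
  shows "(\<kappa> / (2 * CARD('q)))\<^sup>2 / 4 * n * card (wrong_nodes n z w)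
    \<le> card {(t, i, j) \<in> edges n T. \<pi> t $ z i t $ z j t \<noteq> \<pi> t $ w i t $ w j t}"
    (is "?c * real n * _ \<le> real (card ?E)")
proof -
  let ?R = "\<lambda>t. {i \<in> {1..n}. z i t \<noteq> w i t}"
  let ?L = "\<lambda>t. {(i, j). 1 \<le> i \<and> i < j \<and> j \<le> n \<and> \<pi> t $ z i t $ z j t \<noteq> \<pi> t $ w i t $ w j t}"
  have "wrong_nodes n z w \<subseteq> (\<Union>t\<in>{1..T}. ?R t)"
  proof
    fix i assume i: "i \<in> wrong_nodes n z w"
    then have i': "i \<in> {1..n}" "z i \<noteq> w i" by (simp_all add: wrong_nodes_def)
    have "\<exists>t\<in>{1..T}. z i t \<noteq> w i t"
    proof (rule ccontr)
      assume "\<not> ?thesis"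
      then have "z i = w i"
        using z[OF i'(1)] w[OF i'(1)] unfolding paths_def by (rule_tac PiE_ext) auto
      with i'(2) show False ..
    qed
    then obtain t where "t \<in> {1..T}" "z i t \<noteq> w i t" ..
    then show "i \<in> (\<Union>t\<in>{1..T}. ?R t)"
      using i'(1) by (intro UN_I[of t]) simp_all
  qed
  then have "card (wrong_nodes n z w) \<le> card (\<Union>t\<in>{1..T}. ?R t)"
    by (rule card_mono[rotated]) simp
  also have "\<dots> \<le> (\<Sum>t\<in>{1..T}. card (?R t))" by (rule card_UN_le) simp
  finally have "?c * n * card (wrong_nodes n z w) \<le> ?c * n * (\<Sum>t\<in>{1..T}. card (?R t))"
    by (intro mult_left_mono of_nat_mono) simp_all
  also have "\<dots> = (\<Sum>t\<in>{1..T}. ?c * n * card (?R t))" by (simp add: sum_distrib_left)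
  also have "\<dots> \<le> (\<Sum>t\<in>{1..T}. real (card (?L t)))"
  proof (rule sum_mono)
    fix t assume t: "t \<in> {1..T}"
    have sym: "\<pi> t $ q $ l = \<pi> t $ l $ q" for q l
      using bspec[OF Theta_symmetric[OF Theta] t] by (metis transpose_def vec_lambda_beta)
    have diag: "inj (\<lambda>q. \<pi> t $ q $ q)" using Theta_diagonal[OF Theta] t by (rule bspec)
    have rows: "\<exists>l. \<pi> t $ q $ l \<noteq> \<pi> t $ q' $ l" if "q \<noteq> q'" for q q'
      using bspec[OF Theta_rows[OF Theta] t] that by (elim allE impE)
    have "\<kappa> * n \<le> card {i \<in> {1..n}. w i t = q}" for q
      using bal t by (simp add: balanced_def)
    from misclassified_edges[where A = "\<lambda>q l. \<pi> t $ q $ l" and z = "\<lambda>i. z i t" and w = "\<lambda>i. w i t",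
        OF sym diag rows \<kappa> this n]
    show "?c * n * card (?R t) \<le> card (?L t)" .
  qed
  also have "\<dots> = card (SIGMA t:{1..T}. ?L t)"
  proof -
    have "finite (?L t)" for t by (rule finite_subset[of _ "{1..n} \<times> {1..n}"]) auto
    then show ?thesis by (subst card_SigmaI) auto
  qed
  also have "(SIGMA t:{1..T}. ?L t) = ?E" by (auto simp: edges_def)
  finally show ?thesis .
qed

lemma touched_edges:
  "card {(t, i, j) \<in> edges n T. z i \<noteq> w i \<or> z j \<noteq> w j} \<le> 2 * T * n * card (wrong_nodes n z w)"
    (is "card ?E \<le> _")
proof -
  let ?W = "wrong_nodes n z w"
  have fin: "finite ?W" by (simp add: wrong_nodes_def)
  have "?E \<subseteq> {1..T} \<times> (?W \<times> {1..n} \<union> {1..n} \<times> ?W)"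
    by (auto simp: edges_def wrong_nodes_def)
  then have "card ?E \<le> card ({1..T} \<times> (?W \<times> {1..n} \<union> {1..n} \<times> ?W))"
    by (intro card_mono) (use fin in auto)
  also have "\<dots> = T * card (?W \<times> {1..n} \<union> {1..n} \<times> ?W)" by (simp add: card_cartesian_product)
  also have "\<dots> \<le> T * (card (?W \<times> {1..n}) + card ({1..n} \<times> ?W))"
    by (intro mult_left_mono card_Un_le) simp
  also have "\<dots> = 2 * T * n * card ?W" by (simp add: card_cartesian_product algebra_simps)
  finally show ?thesis .
qed

section \<open>Posterior mass away from a point\<close>

text \<open>The conditional law of the first component differs from the point mass at \<open>w0\<close> by at most the
  mass it gives to the other points. A point with odds \<open>r\<close> against \<open>w0\<close> has conditional mass at most
  \<open>r / (r + 1)\<close>, hence at most the square root of \<open>r\<close>. The root is taken because the likelihood ratio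
  itself has expectation \<open>1\<close> under the truth, while its root has a small expectation.\<close>

lemma posterior_deviation:
  fixes M :: "('a \<times> 'b) pmf"
  assumes fin: "finite S" and supp: "\<And>w. (w, x) \<in> set_pmf M \<Longrightarrow> w \<in> S"
    and w0: "0 < pmf M (w0, x)"
  shows "\<bar>\<P>(\<omega> in M. A (fst \<omega>) \<bar> snd \<omega> = x) - of_bool (A w0)\<bar>
    \<le> (\<Sum>w\<in>S - {w0}. sqrt (pmf M (w, x) / pmf M (w0, x)))"
proof -
  define D where "D = measure_pmf.prob M {\<omega>. snd \<omega> = x}"
  define N where "N = measure_pmf.prob M {\<omega>. A (fst \<omega>) \<and> snd \<omega> = x}"
  define U where "U = measure_pmf.prob M {\<omega>. fst \<omega> \<noteq> w0 \<and> snd \<omega> = x}"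
  have U_eq: "U = (\<Sum>w\<in>S - {w0}. pmf M (w, x))"
  proof -
    have "U = measure_pmf.prob M ((\<lambda>w. (w, x)) ` (S - {w0}))"
      unfolding U_def by (intro measure_pmf.finite_measure_eq_AE AE_pmfI) (auto simp: image_iff intro: supp)
    also have "\<dots> = (\<Sum>w\<in>S - {w0}. pmf M (w, x))"
      by (subst measure_measure_pmf_finite) (auto simp: fin sum.reindex inj_on_def)
    finally show ?thesis .
  qed
  have D_ge: "pmf M (w, x) + pmf M (w0, x) \<le> D" if "w \<noteq> w0" for w
  proof -
    have "pmf M (w, x) + pmf M (w0, x) = measure_pmf.prob M {(w, x), (w0, x)}"
      using that by (subst measure_measure_pmf_finite) auto
    also have "\<dots> \<le> D" unfolding D_def by (intro measure_pmf.finite_measure_mono) auto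
    finally show ?thesis .
  qed
  have "pmf M (w0, x) \<le> D"
    unfolding D_def pmf.rep_eq by (intro measure_pmf.finite_measure_mono) auto
  then have D_pos: "0 < D" using w0 by linarith
  have odds: "r / (r + 1) \<le> sqrt r" if "0 \<le> r" for r :: real
  proof -
    have "sqrt r \<le> r + 1" using that by (intro real_le_lsqrt) (simp_all add: power2_sum)
    then have "sqrt r * sqrt r \<le> sqrt r * (r + 1)" using that by (intro mult_left_mono) auto
    then show ?thesis using that by (simp add: pos_divide_le_eq)
  qed
  have summand: "pmf M (w, x) / D \<le> sqrt (pmf M (w, x) / pmf M (w0, x))" if "w \<noteq> w0" for w
  proof -
    let ?s = "pmf M (w, x) / pmf M (w0, x)"
    have s: "0 \<le> ?s" using w0 by simp
    have "pmf M (w, x) / D \<le> pmf M (w, x) / (pmf M (w, x) + pmf M (w0, x))"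
      using D_ge[OF that] w0 by (intro divide_left_mono mult_pos_pos D_pos) (auto intro: add_nonneg_pos)
    also have "\<dots> = ?s / (?s + 1)" using w0 by (simp add: field_simps)
    also have "\<dots> \<le> sqrt ?s" by (rule odds[OF s])
    finally show ?thesis .
  qed
  have "\<bar>N / D - of_bool (A w0)\<bar> \<le> U / D"
  proof (cases "A w0")
    case True
    have "D \<le> N + U"
    proof -
      have "D \<le> measure_pmf.prob M ({\<omega>. A (fst \<omega>) \<and> snd \<omega> = x} \<union> {\<omega>. fst \<omega> \<noteq> w0 \<and> snd \<omega> = x})"
        unfolding D_def using True by (intro measure_pmf.finite_measure_mono) auto
      also have "\<dots> \<le> N + U" unfolding N_def U_def by (rule measure_Un_le) auto
      finally show ?thesis .
    qed
    moreover have "N \<le> D" unfolding N_def D_def by (intro measure_pmf.finite_measure_mono) auto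
    moreover have "N / D - 1 = (N - D) / D" using D_pos by (simp add: field_simps)
    ultimately show ?thesis using True D_pos
      by (simp add: abs_divide) (rule divide_right_mono, auto)
  next
    case False
    then have "N \<le> U" unfolding N_def U_def by (intro measure_pmf.finite_measure_mono) auto
    moreover have "0 \<le> N" by (simp add: N_def)
    ultimately show ?thesis using False D_pos by (simp add: divide_right_mono)
  qed
  also have "U / D = (\<Sum>w\<in>S - {w0}. pmf M (w, x) / D)" by (simp add: U_eq sum_divide_distrib)
  also have "\<dots> \<le> (\<Sum>w\<in>S - {w0}. sqrt (pmf M (w, x) / pmf M (w0, x)))"
    by (intro sum_mono summand) auto
  finally show ?thesis by (simp add: cond_prob_def N_def D_def)
qed

section \<open>The labels and edges of the model\<close>

definition label_set :: "nat \<Rightarrow> nat \<Rightarrow> 'q labels set" where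
  "label_set n T = PiE_dflt {1..n} (\<lambda>_. undefined) (\<lambda>_. paths T)"

lemma label_setD: "z \<in> label_set n T \<Longrightarrow> i \<in> {1..n} \<Longrightarrow> z i \<in> paths T"
  by (simp add: label_set_def PiE_dflt_def)

lemma label_set_outside: "z \<in> label_set n T \<Longrightarrow> \<not> (i \<in> {1..n} \<and> t \<in> {1..T}) \<Longrightarrow> z i t = undefined"
proof (cases "i \<in> {1..n}")
  case True
  assume z: "z \<in> label_set n T" and "\<not> (i \<in> {1..n} \<and> t \<in> {1..T})"
  then have "t \<notin> {1..T}" using True by blast
  then show ?thesis using label_setD[OF z True] unfolding paths_def by (rule PiE_arb[rotated])
next
  case False
  assume z: "z \<in> label_set n T"
  have "z i = (\<lambda>_. undefined)"
    using z False unfolding label_set_def PiE_dflt_def mem_Collect_eq by metis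
  then show ?thesis by simp
qed

lemma finite_label_set: "finite (label_set n T :: 'q::finite labels set)"
  unfolding label_set_def by (intro finite_PiE_dflt finite_paths) auto

lemma set_labels_pmf: "set_pmf (labels_pmf n T \<Gamma>) \<subseteq> label_set n T"
  unfolding labels_pmf_def label_set_def set_Pi_pmf[OF finite_atLeastAtMost]
  using subsetD[OF set_chain_pmf] by (force simp: PiE_dflt_def)

lemma pmf_labels:
  assumes "z \<in> label_set n T"
  shows "pmf (labels_pmf n T \<Gamma>) z = (\<Prod>i\<in>{1..n}. pmf (chain_pmf \<Gamma> T) (z i))"
  unfolding labels_pmf_def using assms by (intro pmf_Pi') (auto simp: label_set_def PiE_dflt_def)

lemma (in positive_chain) pmf_labels_pos:
  assumes "z \<in> label_set n T"
  shows "0 < pmf (labels_pmf n T \<Gamma>) z"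
  unfolding pmf_labels[OF assms]
proof (rule prod_pos)
  fix i assume "i \<in> {1..n}"
  then have "\<delta> ^ T \<le> pmf (chain_pmf \<Gamma> T) (z i)" by (intro chain_pmf_ge label_setD[OF assms])
  then show "0 < pmf (chain_pmf \<Gamma> T) (z i)" using delta_pos by (meson less_le_trans zero_less_power)
qed

lemma prod_wrong_nodes:
  fixes K :: real
  shows "(\<Prod>i\<in>{1..n}. if z i \<noteq> w i then K else 1) = K ^ card (wrong_nodes n z w)"
  by (simp add: prod.If_cases wrong_nodes_def Int_def)

lemma (in positive_chain) prior_ratio:
  assumes z: "z \<in> label_set n T" and w: "w \<in> label_set n T" and "\<delta> \<le> 1"
  shows "pmf (labels_pmf n T \<Gamma>) z
    \<le> (1 / \<delta> ^ T) ^ card (wrong_nodes n z w) * pmf (labels_pmf n T \<Gamma>) w"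
proof -
  have "(\<Prod>i\<in>{1..n}. pmf (chain_pmf \<Gamma> T) (z i))
    \<le> (\<Prod>i\<in>{1..n}. (if z i \<noteq> w i then 1 / \<delta> ^ T else 1) * pmf (chain_pmf \<Gamma> T) (w i))"
  proof (rule prod_mono, rule conjI)
    fix i assume i: "i \<in> {1..n}"
    have "1 \<le> 1 / \<delta> ^ T * pmf (chain_pmf \<Gamma> T) (w i)"
      using chain_pmf_ge[OF label_setD[OF w i]] delta_pos by (simp add: field_simps)
    moreover have "pmf (chain_pmf \<Gamma> T) (z i) \<le> 1" by (rule pmf_le_1)
    ultimately show "pmf (chain_pmf \<Gamma> T) (z i)
      \<le> (if z i \<noteq> w i then 1 / \<delta> ^ T else 1) * pmf (chain_pmf \<Gamma> T) (w i)" by auto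
  qed simp
  then show ?thesis unfolding prod.distrib prod_wrong_nodes pmf_labels[OF z] pmf_labels[OF w] .
qed

text \<open>Values outside the index range stay at the default, so that a relabelling permutes
  \<open>label_set\<close>.\<close>

definition relabel :: "nat \<Rightarrow> nat \<Rightarrow> ('q \<Rightarrow> 'q) \<Rightarrow> 'q labels \<Rightarrow> 'q labels" where
  "relabel n T \<sigma> z = (\<lambda>i t. if i \<in> {1..n} \<and> t \<in> {1..T} then \<sigma> (z i t) else undefined)"

lemma relabel_in: "relabel n T \<sigma> z \<in> label_set n T"
  by (auto simp: relabel_def label_set_def PiE_dflt_def paths_def)

lemma bij_relabel:
  assumes "bij \<sigma>"
  shows "bij_betw (relabel n T \<sigma>) (label_set n T) (label_set n T)"
proof (rule bij_betwI[where g = "relabel n T (inv \<sigma>)"])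
  have *: "relabel n T f (relabel n T g z) = z"
    if "z \<in> label_set n T" "\<And>q. f (g q) = q" for f g :: "'a \<Rightarrow> 'a" and z
    using label_set_outside[OF that(1)] that(2) by (intro ext) (auto simp: relabel_def)
  show "relabel n T (inv \<sigma>) (relabel n T \<sigma> z) = z" if "z \<in> label_set n T" for z
    using that assms by (intro *) (auto simp: bij_def)
  show "relabel n T \<sigma> (relabel n T (inv \<sigma>) z) = z" if "z \<in> label_set n T" for z
    using that assms by (intro *) (auto simp: bij_def surj_f_inv_f)
qed (simp_all add: relabel_in)

lemma wrong_nodes_relabel:
  assumes "bij \<sigma>" and z: "z \<in> label_set n T" and w: "w \<in> label_set n T"
  shows "wrong_nodes n (relabel n T \<sigma> z) (relabel n T \<sigma> w) = wrong_nodes n z w"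
proof -
  have "relabel n T \<sigma> z i = relabel n T \<sigma> w i \<longleftrightarrow> z i = w i" if i: "i \<in> {1..n}" for i
  proof
    assume eq: "relabel n T \<sigma> z i = relabel n T \<sigma> w i"
    show "z i = w i"
    proof
      fix t
      show "z i t = w i t"
      proof (cases "t \<in> {1..T}")
        case True
        then show ?thesis
          using fun_cong[OF eq, of t] i assms(1) by (simp add: relabel_def bij_def inj_eq)
      next
        case False
        then show ?thesis
          using label_set_outside[OF z, of i t] label_set_outside[OF w, of i t] by simp
      qed
    qed
  qed (simp only: relabel_def)
  then show ?thesis by (auto simp: wrong_nodes_def)
qed

text \<open>The model draws one indicator per triple \<open>(t, i, j)\<close> with \<open>i < j\<close> and then symmetrises. The
  likelihood is a product over these triples, so everything is computed for the unsymmetrised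
  indicators; no information is lost, as symmetrisation is injective on the indicators that vanish
  outside the edge set.\<close>

definition symmetrize :: "(nat \<times> nat \<times> nat \<Rightarrow> bool) \<Rightarrow> graphs" where
  "symmetrize e = (\<lambda>t i j. e (t, min i j, max i j))"

definition edge_pmf ::
    "nat \<Rightarrow> nat \<Rightarrow> (nat \<Rightarrow> real^'q::finite^'q) \<Rightarrow> 'q labels \<Rightarrow> (nat \<times> nat \<times> nat \<Rightarrow> bool) pmf" where
  "edge_pmf n T \<pi> z =
     Pi_pmf (edges n T) False (\<lambda>(t, i, j). bernoulli_pmf (\<pi> t $ z i t $ z j t))"

lemma graphs_pmf_eq: "graphs_pmf n T \<pi> z = map_pmf symmetrize (edge_pmf n T \<pi> z)"
  unfolding graphs_pmf_def edge_pmf_def symmetrize_def edges_def ..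

lemma pmf_graphs:
  assumes e: "\<And>a. a \<notin> edges n T \<Longrightarrow> \<not> e a"
  shows "pmf (graphs_pmf n T \<pi> z) (symmetrize e) =
    (\<Prod>(t, i, j)\<in>edges n T. pmf (bernoulli_pmf (\<pi> t $ z i t $ z j t)) (e (t, i, j)))"
proof -
  have inj: "e' = e" if "symmetrize e' = symmetrize e" "\<And>a. a \<notin> edges n T \<Longrightarrow> \<not> e' a" for e'
  proof
    fix a :: "nat \<times> nat \<times> nat"
    obtain t i j where a: "a = (t, i, j)" by (cases a) auto
    show "e' a = e a"
    proof (cases "a \<in> edges n T")
      case True
      then have "i < j" by (simp add: a edges_def)
      then show ?thesis
        using fun_cong[OF fun_cong[OF fun_cong[OF that(1)]], of t i j] by (simp add: a symmetrize_def)
    qed (use that(2) e in auto)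
  qed
  have supp: "\<not> e' a" if "e' \<in> set_pmf (edge_pmf n T \<pi> z)" "a \<notin> edges n T" for e' a
    using subsetD[OF set_Pi_pmf_subset[OF finite_edges] that(1)[unfolded edge_pmf_def]] that(2)
    by (cases a) simp
  have "pmf (graphs_pmf n T \<pi> z) (symmetrize e) = measure_pmf.prob (edge_pmf n T \<pi> z) {e}"
    unfolding graphs_pmf_eq pmf_map
  proof (intro measure_pmf.finite_measure_eq_AE AE_pmfI)
    fix e' assume "e' \<in> set_pmf (edge_pmf n T \<pi> z)"
    from inj[OF _ supp[OF this]] show "e' \<in> symmetrize -` {symmetrize e} \<longleftrightarrow> e' \<in> {e}" by auto
  qed simp_all
  also have "\<dots> = (\<Prod>(t, i, j)\<in>edges n T. pmf (bernoulli_pmf (\<pi> t $ z i t $ z j t)) (e (t, i, j)))"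
    unfolding measure_pmf_single edge_pmf_def
    by (subst pmf_Pi'[OF finite_edges]) (simp_all add: e split_def)
  finally show ?thesis .
qed

lemma pmf_model: "pmf (model_pmf n T \<theta>) (z, x) =
    pmf (labels_pmf n T (fst \<theta>)) z * pmf (graphs_pmf n T (snd \<theta>) z) x"
  by (simp add: model_pmf_def pmf_bind_Pair)

text \<open>Likelihoods are products, so the closeness of the parameters is needed in multiplicative form.\<close>

lemma pmf_bernoulli_close:
  assumes "\<zeta> \<le> p'" "p' \<le> 1 - \<zeta>" "0 < \<zeta>" "0 \<le> p" "p \<le> 1" "\<bar>p - p'\<bar> \<le> \<eta>"
  shows "pmf (bernoulli_pmf p) e \<le> (1 + \<eta> / \<zeta>) * pmf (bernoulli_pmf p') e"
proof -
  have key: "a \<le> (1 + \<eta> / \<zeta>) * b" if "a \<le> b + \<eta>" "\<zeta> \<le> b" for a b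
  proof -
    have "0 \<le> \<eta>" using assms by linarith
    then have "\<eta> * \<zeta> \<le> \<eta> * b" using that by (intro mult_left_mono)
    then have "\<eta> \<le> \<eta> / \<zeta> * b" using \<open>0 < \<zeta>\<close> by (simp add: field_simps)
    then show ?thesis using that by (simp add: algebra_simps)
  qed
  show ?thesis
    using assms by (cases e) (auto intro!: key)
qed

section \<open>A bound on the posterior that is uniform in the parameter\<close>

lemma sqrt_prod: "sqrt (\<Prod>a\<in>A. f a) = (\<Prod>a\<in>A. sqrt (f a))"
  by (induction A rule: infinite_finite_induct) (simp_all add: real_sqrt_mult)

definition edge_prob ::
    "(nat \<Rightarrow> real^'q::finite^'q) \<Rightarrow> 'q labels \<Rightarrow> (nat \<times> nat \<times> nat \<Rightarrow> bool) \<Rightarrow> nat \<times> nat \<times> nat \<Rightarrow> real" where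
  "edge_prob \<pi> z e = (\<lambda>(t, i, j). pmf (bernoulli_pmf (\<pi> t $ z i t $ z j t)) (e (t, i, j)))"

text \<open>Square root of the likelihood ratio of the labellings \<open>z\<close> and \<open>w\<close> given the edges.\<close>

definition root_ratio ::
    "nat \<Rightarrow> nat \<Rightarrow> (nat \<Rightarrow> real^'q::finite^'q) \<Rightarrow> 'q labels \<Rightarrow> 'q labels \<Rightarrow> (nat \<times> nat \<times> nat \<Rightarrow> bool) \<Rightarrow> real"
  where "root_ratio n T \<pi> z w e = (\<Prod>a\<in>edges n T. sqrt (edge_prob \<pi> z e a / edge_prob \<pi> w e a))"

lemma edgesD: "(t, i, j) \<in> edges n T \<Longrightarrow> t \<in> {1..T} \<and> i \<in> {1..n} \<and> j \<in> {1..n}"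
  by (simp add: edges_def)

lemma Theta_pi_bounds:
  assumes "(\<Gamma>, \<pi>) \<in> Theta \<delta> \<zeta> T" "t \<in> {1..T}"
  shows "\<zeta> \<le> \<pi> t $ q $ l" "\<pi> t $ q $ l \<le> 1 - \<zeta>"
  using Theta_pi[OF assms(1)] assms(2) by (metis atLeastAtMost_iff)+

lemma edge_prob_pos:
  assumes "(\<Gamma>, \<pi>) \<in> Theta \<delta> \<zeta> T" "0 < \<zeta>" "a \<in> edges n T"
  shows "0 < edge_prob \<pi> z e a"
proof -
  obtain t i j where a: "a = (t, i, j)" by (cases a) auto
  have "t \<in> {1..T}" using edgesD assms(3) a by blast
  note * = Theta_pi_bounds[OF assms(1) this, of "z i t" "z j t"]
  then show ?thesis using assms(2) by (cases "e (t, i, j)") (simp_all add: a edge_prob_def)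
qed

lemma edge_prob_relabel:
  "(t, i, j) \<in> edges n T \<Longrightarrow> edge_prob \<pi> (relabel n T \<sigma> z) e (t, i, j) =
    pmf (bernoulli_pmf (\<pi> t $ \<sigma> (z i t) $ \<sigma> (z j t))) (e (t, i, j))"
  using edgesD[of t i j n T] by (simp add: edge_prob_def relabel_def)

lemma positive_chain_Theta:
  assumes "(\<Gamma>, \<pi>) \<in> Theta \<delta> \<zeta> T" "0 < \<delta>"
  shows "positive_chain \<Gamma> \<delta>"
  using Theta_row_sum[OF assms(1)] Theta_Gamma[OF assms(1)] assms(2)
  by unfold_locales (simp_all)

text \<open>The right-hand side does not involve \<open>\<Gamma>\<close>, \<open>\<pi>\<close> or \<open>\<sigma>\<close>; this is how a data-dependent estimator is
  handled. The posterior under \<open>(\<Gamma>, \<pi>)\<close> is compared with the relabelled truth: labellings are written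
  as \<open>\<sigma> \<circ> z\<close>, which turns \<open>\<pi>\<close> into \<open>\<pi>\<^sub>\<sigma>\<close>, a matrix close to \<open>\<pi>'\<close>, while the prior changes by at most a
  fixed factor per wrong node. Replacing \<open>\<pi>\<^sub>\<sigma>\<close> by \<open>\<pi>'\<close> costs a factor \<open>\<tau>\<^sup>2\<close> per
  edge with a wrong endpoint, since all other edges cancel in the ratio; there are at most
  \<open>2 T n\<close> such edges per wrong node.\<close>

lemma posterior_bound:
  fixes \<pi> \<pi>' :: "nat \<Rightarrow> real^'q::finite^'q"
  assumes Theta: "(\<Gamma>, \<pi>) \<in> Theta \<delta> \<zeta> T" and Theta': "(\<Gamma>', \<pi>') \<in> Theta \<delta> \<zeta> T"
    and \<delta>: "0 < \<delta>" "\<delta> \<le> 1" and \<zeta>: "0 < \<zeta>" and \<sigma>: "bij \<sigma>" and \<tau>: "1 \<le> \<tau>"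
    and close: "\<And>t q l. t \<in> {1..T} \<Longrightarrow> \<bar>\<pi> t $ \<sigma> q $ \<sigma> l - \<pi>' t $ q $ l\<bar> \<le> \<zeta> * (\<tau> - 1)"
    and w: "w \<in> label_set n T" and e: "\<And>a. a \<notin> edges n T \<Longrightarrow> \<not> e a"
  shows "\<bar>\<P>(\<omega> in model_pmf n T (\<Gamma>, \<pi>). A (fst \<omega>) \<bar> snd \<omega> = symmetrize e) - of_bool (A (relabel n T \<sigma> w))\<bar>
    \<le> (\<Sum>z\<in>label_set n T - {w}.
        (sqrt (1 / \<delta> ^ T) * \<tau> ^ (2 * T * n)) ^ card (wrong_nodes n z w) * root_ratio n T \<pi>' z w e)"
proof -
  interpret positive_chain \<Gamma> \<delta> by (rule positive_chain_Theta[OF Theta \<delta>(1)])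
  let ?M = "model_pmf n T (\<Gamma>, \<pi>)" and ?x = "symmetrize e" and ?R = "relabel n T \<sigma>"
  let ?L = "label_set n T :: 'q labels set"
  have pmf_M: "pmf ?M (z, ?x) = pmf (labels_pmf n T \<Gamma>) z * (\<Prod>a\<in>edges n T. edge_prob \<pi> z e a)" for z
  proof -
    have "pmf (graphs_pmf n T \<pi> z) ?x = (\<Prod>a\<in>edges n T. edge_prob \<pi> z e a)"
      unfolding edge_prob_def by (rule pmf_graphs) (rule e)
    then show ?thesis by (simp add: pmf_model)
  qed
  have pos: "0 < pmf ?M (z, ?x)" if "z \<in> ?L" for z
    unfolding pmf_M by (intro mult_pos_pos pmf_labels_pos that prod_pos edge_prob_pos[OF Theta \<zeta>])
  have supp: "z \<in> ?L" if "(z, ?x) \<in> set_pmf ?M" for z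
  proof -
    have "0 < pmf (labels_pmf n T \<Gamma>) z"
      using that pmf_M[of z] by (metis mult_zero_left order_less_le pmf_nonneg set_pmf_iff)
    then show ?thesis using set_labels_pmf by (metis pmf_positive_iff subsetD)
  qed
  have "\<bar>\<P>(\<omega> in ?M. A (fst \<omega>) \<bar> snd \<omega> = ?x) - of_bool (A (?R w))\<bar>
      \<le> (\<Sum>z\<in>?L - {?R w}. sqrt (pmf ?M (z, ?x) / pmf ?M (?R w, ?x)))"
    by (intro posterior_deviation finite_label_set supp pos relabel_in)
  also have "\<dots> = (\<Sum>z\<in>?L - {w}. sqrt (pmf ?M (?R z, ?x) / pmf ?M (?R w, ?x)))"
  proof (rule sum.reindex_bij_betw[symmetric])
    show "bij_betw ?R (?L - {w}) (?L - {?R w})"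
      by (intro bij_betw_DiffI bij_relabel \<sigma>) (simp_all add: w relabel_in)
  qed
  also have "\<dots> \<le> (\<Sum>z\<in>?L - {w}.
      (sqrt (1 / \<delta> ^ T) * \<tau> ^ (2 * T * n)) ^ card (wrong_nodes n z w) * root_ratio n T \<pi>' z w e)"
  proof (rule sum_mono)
    fix z assume "z \<in> ?L - {w}"
    then have z: "z \<in> ?L" by blast
    let ?d = "card (wrong_nodes n z w)"
    define touched where "touched a = (case a of (t, i, j) \<Rightarrow> z i \<noteq> w i \<or> z j \<noteq> w j)"
      for a :: "nat \<times> nat \<times> nat"
    have prior: "pmf (labels_pmf n T \<Gamma>) (?R z) / pmf (labels_pmf n T \<Gamma>) (?R w) \<le> (1 / \<delta> ^ T) ^ ?d"
      using prior_ratio[of "?R z" n T "?R w"] \<delta> pmf_labels_pos[of "?R w" n T]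
      by (simp add: relabel_in wrong_nodes_relabel[OF \<sigma> z w] pos_divide_le_eq)
    have edge: "edge_prob \<pi> (?R z) e a / edge_prob \<pi> (?R w) e a
        \<le> (if touched a then \<tau>\<^sup>2 else 1) * (edge_prob \<pi>' z e a / edge_prob \<pi>' w e a)"
      if a: "a \<in> edges n T" for a
    proof -
      obtain t i j where aeq: "a = (t, i, j)" by (cases a) auto
      have t: "t \<in> {1..T}" using edgesD a aeq by blast
      have *: "edge_prob \<pi> (?R y) e a \<le> \<tau> * edge_prob \<pi>' y e a \<and>
          edge_prob \<pi>' y e a \<le> \<tau> * edge_prob \<pi> (?R y) e a" for y
      proof -
        have \<tau>_eq: "\<tau> = 1 + \<zeta> * (\<tau> - 1) / \<zeta>" using \<zeta> by simp
        note b = Theta_pi_bounds[OF Theta t, of "\<sigma> (y i t)" "\<sigma> (y j t)"]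
          and b' = Theta_pi_bounds[OF Theta' t, of "y i t" "y j t"]
          and c = close[OF t, of "y i t" "y j t"]
        have r: "edge_prob \<pi> (?R y) e a = pmf (bernoulli_pmf (\<pi> t $ \<sigma> (y i t) $ \<sigma> (y j t))) (e a)"
          using a unfolding aeq by (rule edge_prob_relabel)
        have s: "edge_prob \<pi>' y e a = pmf (bernoulli_pmf (\<pi>' t $ y i t $ y j t)) (e a)"
          by (simp add: aeq edge_prob_def)
        show ?thesis unfolding r s using b b' c \<zeta>
          by (intro conjI; subst \<tau>_eq; intro pmf_bernoulli_close) (simp_all add: abs_minus_commute)
      qed
      note p = edge_prob_pos[OF Theta \<zeta> a, of _ e] and p' = edge_prob_pos[OF Theta' \<zeta> a, of _ e]
      show ?thesis
      proof (cases "touched a")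
        case True
        have "edge_prob \<pi> (?R z) e a / edge_prob \<pi> (?R w) e a
            \<le> (\<tau> * edge_prob \<pi>' z e a) / (edge_prob \<pi>' w e a / \<tau>)"
          using *[of z] *[of w] p' p \<tau>
          by (intro frac_le) (auto simp: pos_divide_le_eq mult.commute less_imp_le)
        then show ?thesis using True by (simp add: power2_eq_square mult_ac)
      next
        case False
        then have "edge_prob \<pi> (?R z) e a = edge_prob \<pi> (?R w) e a"
          "edge_prob \<pi>' z e a = edge_prob \<pi>' w e a"
          by (simp_all add: aeq touched_def edge_prob_def relabel_def)
        then show ?thesis using False p[of "?R w"] p'[of w] by simp
      qed
    qed
    have "pmf ?M (?R z, ?x) / pmf ?M (?R w, ?x) =
        pmf (labels_pmf n T \<Gamma>) (?R z) / pmf (labels_pmf n T \<Gamma>) (?R w) *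
        (\<Prod>a\<in>edges n T. edge_prob \<pi> (?R z) e a / edge_prob \<pi> (?R w) e a)"
      unfolding pmf_M by (simp add: prod_dividef)
    also have "\<dots> \<le> (1 / \<delta> ^ T) ^ ?d *
        (\<Prod>a\<in>edges n T. (if touched a then \<tau>\<^sup>2 else 1) * (edge_prob \<pi>' z e a / edge_prob \<pi>' w e a))"
      using \<delta>
      by (intro mult_mono prior prod_mono conjI edge prod_nonneg divide_nonneg_nonneg)
        (auto simp: edge_prob_pos[OF Theta \<zeta>] less_imp_le)
    finally have "sqrt (pmf ?M (?R z, ?x) / pmf ?M (?R w, ?x)) \<le> sqrt ((1 / \<delta> ^ T) ^ ?d *
        (\<Prod>a\<in>edges n T. (if touched a then \<tau>\<^sup>2 else 1) * (edge_prob \<pi>' z e a / edge_prob \<pi>' w e a)))"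
      by (rule real_sqrt_le_mono)
    also have "\<dots> = sqrt (1 / \<delta> ^ T) ^ ?d *
        (\<Prod>a\<in>edges n T. (if touched a then \<tau> else 1) * sqrt (edge_prob \<pi>' z e a / edge_prob \<pi>' w e a))"
      unfolding real_sqrt_mult sqrt_prod real_sqrt_power
      using \<tau> by (intro arg_cong2[of _ _ _ _ "(*)"] refl prod.cong) auto
    also have "\<dots> = sqrt (1 / \<delta> ^ T) ^ ?d * \<tau> ^ card {a \<in> edges n T. touched a} * root_ratio n T \<pi>' z w e"
      unfolding prod.distrib root_ratio_def
      by (simp add: prod.If_cases finite_edges Int_def)
    also have "\<dots> \<le> sqrt (1 / \<delta> ^ T) ^ ?d * \<tau> ^ (2 * T * n * ?d) * root_ratio n T \<pi>' z w e"
    proof -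
      have "{a \<in> edges n T. touched a} = {(t, i, j) \<in> edges n T. z i \<noteq> w i \<or> z j \<noteq> w j}"
        by (auto simp: touched_def)
      then have "card {a \<in> edges n T. touched a} \<le> 2 * T * n * ?d"
        using touched_edges[of n T z w] by simp
      moreover have "0 \<le> root_ratio n T \<pi>' z w e"
        unfolding root_ratio_def
        by (intro prod_nonneg ballI real_sqrt_ge_zero divide_nonneg_nonneg less_imp_le
            edge_prob_pos[OF Theta' \<zeta>])
      ultimately show ?thesis
        using \<tau> \<delta> by (intro mult_right_mono mult_left_mono power_increasing) auto
    qed
    also have "\<dots> = (sqrt (1 / \<delta> ^ T) * \<tau> ^ (2 * T * n)) ^ ?d * root_ratio n T \<pi>' z w e"
      by (simp add: power_mult_distrib power_mult)
    finally show "sqrt (pmf ?M (?R z, ?x) / pmf ?M (?R w, ?x))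
      \<le> (sqrt (1 / \<delta> ^ T) * \<tau> ^ (2 * T * n)) ^ ?d * root_ratio n T \<pi>' z w e" .
  qed
  finally show ?thesis .
qed

section \<open>Expected root likelihood ratios\<close>

text \<open>Squared Hellinger distance of two Bernoulli laws.\<close>

definition hellinger :: "real \<Rightarrow> real \<Rightarrow> real" where
  "hellinger p q = ((sqrt p - sqrt q)\<^sup>2 + (sqrt (1 - p) - sqrt (1 - q))\<^sup>2) / 2"

lemma hellinger_nonneg: "0 \<le> hellinger p q"
  by (simp add: hellinger_def)

lemma hellinger_pos: "p \<noteq> q \<Longrightarrow> 0 < hellinger p q"
  by (auto simp: hellinger_def intro!: add_pos_nonneg)

text \<open>The expectation is the Bhattacharyya coefficient, which equals one minus the squared Hellinger
  distance.\<close>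

lemma expectation_root_bernoulli_ratio:
  assumes p: "0 < p" "p < 1" and q: "0 < q" "q < 1"
  shows "measure_pmf.expectation (bernoulli_pmf q)
      (\<lambda>v. sqrt (pmf (bernoulli_pmf p) v / pmf (bernoulli_pmf q) v)) \<le> exp (- hellinger p q)"
proof -
  have cancel: "sqrt (a / b) * b = sqrt a * sqrt b" if "0 < b" for a b :: real
    using that by (simp add: real_sqrt_divide field_simps)
  have "measure_pmf.expectation (bernoulli_pmf q)
      (\<lambda>v. sqrt (pmf (bernoulli_pmf p) v / pmf (bernoulli_pmf q) v))
    = sqrt p * sqrt q + sqrt (1 - p) * sqrt (1 - q)"
    using p q by (simp add: cancel)
  also have "\<dots> = 1 + - hellinger p q"
    using p q by (simp add: hellinger_def power2_diff field_simps)
  also have "\<dots> \<le> exp (- hellinger p q)" by (rule exp_ge_add_one_self)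
  finally show ?thesis .
qed

lemma finite_uniform_pos:
  fixes f :: "'a \<Rightarrow> real"
  assumes "finite A" "\<And>a. a \<in> A \<Longrightarrow> 0 < f a"
  shows "\<exists>b>0. \<forall>a\<in>A. b \<le> f a"
proof (cases "A = {}")
  case False
  then have "0 < Min (f ` A)" "\<forall>a\<in>A. Min (f ` A) \<le> f a" using assms by auto
  then show ?thesis by blast
qed (auto intro: exI[of _ 1])

text \<open>By independence the expectation is a product of Bhattacharyya coefficients; they are at most
  \<open>1\<close>, and at most \<open>exp (- b)\<close> on the informative edges.\<close>

lemma expectation_root_ratio:
  fixes \<pi> :: "nat \<Rightarrow> real^'q::finite^'q"
  assumes Theta: "(\<Gamma>, \<pi>) \<in> Theta \<delta> \<zeta> T" and \<zeta>: "0 < \<zeta>"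
    and b: "\<And>t q l q' l'. t \<in> {1..T} \<Longrightarrow> \<pi> t $ q $ l \<noteq> \<pi> t $ q' $ l' \<Longrightarrow>
      b \<le> hellinger (\<pi> t $ q $ l) (\<pi> t $ q' $ l')"
  shows "measure_pmf.expectation (edge_pmf n T \<pi> w) (root_ratio n T \<pi> z w)
    \<le> exp (- b) ^ card {(t, i, j) \<in> edges n T. \<pi> t $ z i t $ z j t \<noteq> \<pi> t $ w i t $ w j t}"
proof -
  let ?p = "\<lambda>z (t, i, j). \<pi> t $ (z :: 'q labels) i t $ z j t"
  have prob: "edge_prob \<pi> z e a = pmf (bernoulli_pmf (?p z a)) (e a)" for z e a
    by (cases a) (simp add: edge_prob_def)
  have bounds: "0 < ?p y a \<and> ?p y a < 1" if a: "a \<in> edges n T" for y a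
  proof -
    obtain t i j where aeq: "a = (t, i, j)" by (cases a) auto
    have "t \<in> {1..T}" using edgesD a aeq by blast
    from Theta_pi_bounds[OF Theta this, of "y i t" "y j t"] show ?thesis using \<zeta> by (simp add: aeq)
  qed
  have "measure_pmf.expectation (edge_pmf n T \<pi> w) (root_ratio n T \<pi> z w) =
      measure_pmf.expectation (Pi_pmf (edges n T) False (\<lambda>a. bernoulli_pmf (?p w a)))
        (\<lambda>e. \<Prod>a\<in>edges n T. (\<lambda>v. sqrt (pmf (bernoulli_pmf (?p z a)) v / pmf (bernoulli_pmf (?p w a)) v)) (e a))"
  proof -
    have "(\<lambda>(t, i, j). bernoulli_pmf (\<pi> t $ w i t $ w j t)) = (\<lambda>a. bernoulli_pmf (?p w a))"
      by (simp add: fun_eq_iff)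
    then show ?thesis unfolding edge_pmf_def root_ratio_def prob by simp
  qed
  also have "\<dots> = (\<Prod>a\<in>edges n T. measure_pmf.expectation (bernoulli_pmf (?p w a))
      (\<lambda>v. sqrt (pmf (bernoulli_pmf (?p z a)) v / pmf (bernoulli_pmf (?p w a)) v)))"
    by (rule expectation_prod_Pi_pmf) (simp_all add: finite_edges integrable_measure_pmf_finite)
  also have "\<dots> \<le> (\<Prod>a\<in>edges n T. if ?p z a \<noteq> ?p w a then exp (- b) else 1)"
  proof (rule prod_mono, rule conjI)
    fix a assume a: "a \<in> edges n T"
    obtain t i j where aeq: "a = (t, i, j)" by (cases a) auto
    have t: "t \<in> {1..T}" using edgesD a aeq by blast
    have "exp (- hellinger (?p z a) (?p w a)) \<le> (if ?p z a \<noteq> ?p w a then exp (- b) else 1)"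
      using b[OF t, of "z i t" "z j t" "w i t" "w j t"] hellinger_nonneg by (simp add: aeq)
    with expectation_root_bernoulli_ratio[of "?p z a" "?p w a"] bounds[OF a]
    show "measure_pmf.expectation (bernoulli_pmf (?p w a))
        (\<lambda>v. sqrt (pmf (bernoulli_pmf (?p z a)) v / pmf (bernoulli_pmf (?p w a)) v))
      \<le> (if ?p z a \<noteq> ?p w a then exp (- b) else 1)"
      by (meson order_trans)
  qed (intro Bochner_Integration.integral_nonneg, simp)
  also have "\<dots> = exp (- b) ^ card {a \<in> edges n T. ?p z a \<noteq> ?p w a}"
    by (simp add: prod.If_cases finite_edges Int_def)
  also have "{a \<in> edges n T. ?p z a \<noteq> ?p w a} =
      {(t, i, j) \<in> edges n T. \<pi> t $ z i t $ z j t \<noteq> \<pi> t $ w i t $ w j t}"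
    by auto
  finally show ?thesis .
qed

lemma sum_prod_PiE_dflt:
  fixes f :: "'a \<Rightarrow> 'b \<Rightarrow> 'c::comm_semiring_1"
  assumes A: "finite A" and B: "\<And>x. x \<in> A \<Longrightarrow> finite (B x)"
  shows "(\<Sum>g\<in>PiE_dflt A d B. \<Prod>x\<in>A. f x (g x)) = (\<Prod>x\<in>A. \<Sum>y\<in>B x. f x y)"
proof -
  have inj: "inj_on (\<lambda>h. restrict h A) (PiE_dflt A d B)"
  proof (rule inj_onI, rule ext)
    fix g h x
    assume g: "g \<in> PiE_dflt A d B" and h: "h \<in> PiE_dflt A d B" and eq: "restrict g A = restrict h A"
    show "g x = h x"
    proof (cases "x \<in> A")
      case True
      then show ?thesis using fun_cong[OF eq, of x] by simp
    next
      case False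
      then have "g x = d" "h x = d" using g h unfolding PiE_dflt_def by blast+
      then show ?thesis by simp
    qed
  qed
  have "(\<Prod>x\<in>A. \<Sum>y\<in>B x. f x y) = (\<Sum>g\<in>PiE A B. \<Prod>x\<in>A. f x (g x))"
    using A B by (rule prod_sum_PiE)
  also have "\<dots> = (\<Sum>g\<in>PiE_dflt A d B. \<Prod>x\<in>A. f x (restrict g A x))"
    unfolding restrict_PiE_dflt[of A d B, symmetric] by (subst sum.reindex[OF inj]) simp
  finally show ?thesis by simp
qed

text \<open>The sum over all labellings factorises over the nodes, each node contributing \<open>1\<close> for the
  right trajectory and \<open>\<rho>\<close> for every other one. So the number of labellings, exponential in \<open>n\<close>, does
  no harm as soon as \<open>n \<rho>\<close> is small.\<close>

lemma sum_power_wrong_nodes: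
  fixes \<rho> :: real and w :: "'q::finite labels"
  assumes w: "w \<in> label_set n T" and \<rho>: "0 \<le> \<rho>"
  shows "(\<Sum>z\<in>label_set n T - {w}. \<rho> ^ card (wrong_nodes n z w))
    \<le> exp (real n * (real (card (paths T :: (nat \<Rightarrow> 'q) set)) * \<rho>)) - 1"
proof -
  let ?P = "paths T :: (nat \<Rightarrow> 'q) set"
  have ww: "wrong_nodes n w w = {}" by (simp add: wrong_nodes_def)
  have "(\<Sum>z\<in>label_set n T. \<rho> ^ card (wrong_nodes n z w)) =
      (\<Sum>z\<in>label_set n T. \<Prod>i\<in>{1..n}. if z i \<noteq> w i then \<rho> else 1)"
    by (simp only: prod_wrong_nodes)
  also have "\<dots> = (\<Prod>i\<in>{1..n}. \<Sum>y\<in>?P. if y \<noteq> w i then \<rho> else 1)"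
    unfolding label_set_def by (rule sum_prod_PiE_dflt) (simp_all add: finite_paths)
  also have "\<dots> \<le> (\<Prod>i\<in>{1..n}. exp (real (card ?P) * \<rho>))"
  proof (rule prod_mono, rule conjI)
    fix i assume i: "i \<in> {1..n}"
    have "(\<Sum>y\<in>?P. if y \<noteq> w i then \<rho> else 1) = 1 + (\<Sum>y\<in>?P - {w i}. if y \<noteq> w i then \<rho> else 1)"
      by (subst sum.remove[OF finite_paths label_setD[OF w i]]) simp
    also have "(\<Sum>y\<in>?P - {w i}. if y \<noteq> w i then \<rho> else 1) \<le> (\<Sum>y\<in>?P - {w i}. \<rho>)"
      by (intro sum_mono) simp
    also have "\<dots> \<le> real (card ?P) * \<rho>"
      using \<rho> card_mono[OF finite_paths, of "?P - {w i}" T]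
      by (simp add: mult_right_mono)
    finally have "(\<Sum>y\<in>?P. if y \<noteq> w i then \<rho> else 1) \<le> 1 + real (card ?P) * \<rho>" by simp
    also have "\<dots> \<le> exp (real (card ?P) * \<rho>)" by (rule exp_ge_add_one_self)
    finally show "(\<Sum>y\<in>?P. if y \<noteq> w i then \<rho> else 1) \<le> exp (real (card ?P) * \<rho>)" .
  qed (use \<rho> in \<open>simp add: sum_nonneg\<close>)
  also have "\<dots> = exp (real n * (real (card ?P) * \<rho>))"
    by (simp add: exp_of_nat_mult)
  finally show ?thesis
    using w by (simp add: sum_diff1 finite_label_set ww)
qed

section \<open>Uniform recovery of the labels\<close>

lemma prob_bind_pmf_le:
  assumes "\<And>z. z \<in> set_pmf p \<Longrightarrow> measure_pmf.prob (f z) A \<le> c"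
  shows "measure_pmf.prob (bind_pmf p f) A \<le> c"
proof -
  have eq: "measure_pmf.prob M A = pmf (map_pmf (\<lambda>\<omega>. \<omega> \<in> A) M) True" for M
    by (simp add: pmf_map vimage_def)
  have "measure_pmf.prob (bind_pmf p f) A = measure_pmf.expectation p (\<lambda>z. measure_pmf.prob (f z) A)"
    unfolding eq by (simp add: map_bind_pmf pmf_bind)
  also have "\<dots> \<le> c"
    using assms
    by (intro measure_pmf.integral_le_const AE_pmfI measure_pmf.integrable_const_bound[where B = 1]) auto
  finally show ?thesis .
qed

text \<open>The accuracy \<open>1 / n\<close> makes the errors of the expected transition counts, which are sums of fewer
  than \<open>n T\<close> posterior probabilities, bounded. The parameter is quantified inside, since the property
  is applied to an estimator, a function of the same \<open>x\<close>.\<close>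

definition recovers ::
    "real \<Rightarrow> real \<Rightarrow> real \<Rightarrow> nat \<Rightarrow> nat \<Rightarrow> (nat \<Rightarrow> real^'q::finite^'q) \<Rightarrow> 'q labels \<Rightarrow> graphs \<Rightarrow> bool" where
  "recovers \<delta> \<zeta> \<eta> n T \<pi>' w x \<longleftrightarrow> (\<forall>\<theta>\<in>Theta \<delta> \<zeta> T. \<forall>\<sigma>. bij \<sigma> \<longrightarrow>
     (\<forall>t\<in>{1..T}. \<forall>q l. \<bar>snd \<theta> t $ \<sigma> q $ \<sigma> l - \<pi>' t $ q $ l\<bar> \<le> \<eta>) \<longrightarrow>
     (\<forall>A. \<bar>\<P>(\<omega> in model_pmf n T \<theta>. A (fst \<omega>) \<bar> snd \<omega> = x) - of_bool (A (relabel n T \<sigma> w))\<bar> \<le> 1 / real n))"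

text \<open>Markov's inequality for the bound of the previous sections: each wrong node contributes a factor
  that combines the cost of the prior, the cost of the perturbation of \<open>\<pi>'\<close>, and the gain
  \<open>exp (- b c n)\<close> of its informative edges.\<close>

lemma recovery_failure_prob:
  fixes \<pi>' :: "nat \<Rightarrow> real^'q::finite^'q"
  assumes Theta': "(\<Gamma>', \<pi>') \<in> Theta \<delta> \<zeta> T"
    and \<delta>: "0 < \<delta>" "\<delta> \<le> 1" and \<zeta>: "0 < \<zeta>" and \<tau>: "1 \<le> \<tau>"
    and b: "0 < b" "\<And>t q l q' l'. t \<in> {1..T} \<Longrightarrow> \<pi>' t $ q $ l \<noteq> \<pi>' t $ q' $ l' \<Longrightarrow>
      b \<le> hellinger (\<pi>' t $ q $ l) (\<pi>' t $ q' $ l')"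
    and \<kappa>: "0 < \<kappa>" "\<kappa> \<le> 1" and n: "1 \<le> n" "2 \<le> (\<kappa> / (2 * CARD('q)))\<^sup>2 * n"
    and w: "w \<in> label_set n T" and bal: "balanced \<kappa> n T w"
  defines "c \<equiv> (\<kappa> / (2 * CARD('q)))\<^sup>2 / 4"
  shows "measure_pmf.prob (edge_pmf n T \<pi>' w) {e. \<not> recovers \<delta> \<zeta> (\<zeta> * (\<tau> - 1)) n T \<pi>' w (symmetrize e)}
    \<le> real n * (exp (real n * (real (card (paths T :: (nat \<Rightarrow> 'q) set)) *
        (sqrt (1 / \<delta> ^ T) * \<tau> ^ (2 * T * n) * exp (- (b * c * n))))) - 1)"
proof -
  let ?L = "label_set n T :: 'q labels set" and ?p = "edge_pmf n T \<pi>' w"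
  define K where "K = sqrt (1 / \<delta> ^ T) * \<tau> ^ (2 * T * n)"
  define B where "B e = (\<Sum>z\<in>?L - {w}. K ^ card (wrong_nodes n z w) * root_ratio n T \<pi>' z w e)" for e
  have K: "0 \<le> K" using \<delta> \<tau> by (simp add: K_def)
  have fin: "finite (set_pmf ?p)"
    unfolding edge_pmf_def set_Pi_pmf[OF finite_edges] by (rule finite_PiE_dflt) (auto simp: finite_edges)
  have off: "\<not> e a" if "e \<in> set_pmf ?p" "a \<notin> edges n T" for e a
    using subsetD[OF set_Pi_pmf_subset[OF finite_edges] that(1)[unfolded edge_pmf_def]] that(2)
    by (cases a) simp
  have root_nonneg: "0 \<le> root_ratio n T \<pi>' z w e" for z e
    unfolding root_ratio_def
    by (intro prod_nonneg ballI real_sqrt_ge_zero divide_nonneg_nonneg less_imp_le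
        edge_prob_pos[OF Theta' \<zeta>])
  have B_nonneg: "0 \<le> B e" for e
    unfolding B_def using K by (intro sum_nonneg mult_nonneg_nonneg root_nonneg) auto
  have fail: "1 / real n \<le> B e"
    if e: "e \<in> set_pmf ?p" and nr: "\<not> recovers \<delta> \<zeta> (\<zeta> * (\<tau> - 1)) n T \<pi>' w (symmetrize e)" for e
  proof -
    from nr obtain \<theta> \<sigma> A where \<theta>: "\<theta> \<in> Theta \<delta> \<zeta> T" and \<sigma>: "bij \<sigma>"
      and close: "\<forall>t\<in>{1..T}. \<forall>q l. \<bar>snd \<theta> t $ \<sigma> q $ \<sigma> l - \<pi>' t $ q $ l\<bar> \<le> \<zeta> * (\<tau> - 1)"
      and far: "\<not> \<bar>\<P>(\<omega> in model_pmf n T \<theta>. A (fst \<omega>) \<bar> snd \<omega> = symmetrize e)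
        - of_bool (A (relabel n T \<sigma> w))\<bar> \<le> 1 / real n"
      unfolding recovers_def by blast
    obtain \<Gamma> \<pi> where \<theta>_eq: "\<theta> = (\<Gamma>, \<pi>)" by (cases \<theta>)
    have close': "\<bar>\<pi> t $ \<sigma> q $ \<sigma> l - \<pi>' t $ q $ l\<bar> \<le> \<zeta> * (\<tau> - 1)" if "t \<in> {1..T}" for t q l
      using close that by (simp add: \<theta>_eq)
    have "\<bar>\<P>(\<omega> in model_pmf n T (\<Gamma>, \<pi>). A (fst \<omega>) \<bar> snd \<omega> = symmetrize e)
        - of_bool (A (relabel n T \<sigma> w))\<bar> \<le> B e"
      unfolding B_def K_def
      by (rule posterior_bound[OF \<theta>[unfolded \<theta>_eq] Theta' \<delta> \<zeta> \<sigma> \<tau> close' w off[OF e]])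
    then show ?thesis using far unfolding \<theta>_eq by linarith
  qed
  have term_le: "measure_pmf.expectation ?p (root_ratio n T \<pi>' z w)
      \<le> exp (- (b * c * n)) ^ card (wrong_nodes n z w)" if z: "z \<in> ?L" for z
  proof -
    let ?m = "card {(t, i, j) \<in> edges n T. \<pi>' t $ z i t $ z j t \<noteq> \<pi>' t $ w i t $ w j t}"
    have "measure_pmf.expectation ?p (root_ratio n T \<pi>' z w) \<le> exp (- b) ^ ?m"
      by (rule expectation_root_ratio[OF Theta' \<zeta> b(2)])
    also have "\<dots> = exp (- (b * real ?m))" by (simp add: exp_of_nat_mult[symmetric])
    also have "\<dots> \<le> exp (- (b * (c * n * card (wrong_nodes n z w))))"
    proof -
      have "c * n * card (wrong_nodes n z w) \<le> ?m"
        unfolding c_def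
        by (rule informative_edges[OF Theta' _ _ \<kappa> bal n(2)]) (erule label_setD[OF z], erule label_setD[OF w])
      then have "b * (c * n * card (wrong_nodes n z w)) \<le> b * ?m"
        using b(1) by (intro mult_left_mono) auto
      then show ?thesis by simp
    qed
    also have "\<dots> = exp (- (b * c * n)) ^ card (wrong_nodes n z w)"
      by (simp add: exp_of_nat_mult[symmetric])
    finally show ?thesis .
  qed
  have "measure_pmf.prob ?p {e. \<not> recovers \<delta> \<zeta> (\<zeta> * (\<tau> - 1)) n T \<pi>' w (symmetrize e)}
      \<le> measure_pmf.prob ?p {e. 1 / real n \<le> B e}"
    using fail by (intro measure_pmf.finite_measure_mono_AE AE_pmfI) auto
  also have "\<dots> \<le> measure_pmf.expectation ?p B / (1 / real n)"
    using integral_Markov_inequality_measure[of ?p B UNIV "1 / real n"] n B_nonneg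
    by (simp add: integrable_measure_pmf_finite[OF fin])
  also have "\<dots> = real n * measure_pmf.expectation ?p B" by simp
  also have "measure_pmf.expectation ?p B =
      (\<Sum>z\<in>?L - {w}. K ^ card (wrong_nodes n z w) * measure_pmf.expectation ?p (root_ratio n T \<pi>' z w))"
    unfolding B_def by (simp add: integrable_measure_pmf_finite[OF fin])
  also have "\<dots> \<le> (\<Sum>z\<in>?L - {w}. (K * exp (- (b * c * n))) ^ card (wrong_nodes n z w))"
    unfolding power_mult_distrib using K by (intro sum_mono mult_left_mono term_le) auto
  also have "\<dots> \<le> exp (real n * (real (card (paths T :: (nat \<Rightarrow> 'q) set)) * (K * exp (- (b * c * n))))) - 1"
    using K by (intro sum_power_wrong_nodes w) simp
  finally show ?thesis by (simp add: K_def mult_left_mono)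
qed

text \<open>Closeness up to a fixed \<open>\<eta>\<close> suffices, because the perturbation and the information both act
  exponentially in \<open>n\<close> per wrong node: \<open>\<eta>\<close> is chosen so that the former uses up half of the latter.\<close>

lemma posterior_concentration:
  fixes \<Gamma>' :: "real^'q::finite^'q"
  assumes Theta': "(\<Gamma>', \<pi>') \<in> Theta \<delta> \<zeta> T"
    and \<delta>: "0 < \<delta>" "\<delta> \<le> 1" and \<zeta>: "0 < \<zeta>" and T: "1 \<le> T" and \<kappa>: "0 < \<kappa>" "\<kappa> \<le> 1"
  shows "\<exists>\<eta>>0. (\<lambda>n. measure_pmf.prob (model_pmf n T (\<Gamma>', \<pi>'))
    {\<omega>. balanced \<kappa> n T (fst \<omega>) \<and> \<not> recovers \<delta> \<zeta> \<eta> n T \<pi>' (fst \<omega>) (snd \<omega>)}) \<longlonglongrightarrow> 0"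
proof -
  define c where "c = (\<kappa> / (2 * CARD('q)))\<^sup>2 / 4"
  have c: "0 < c" using \<kappa> by (simp add: c_def)
  define D where "D = {(t, q, l, q', l'). t \<in> {1..T} \<and> \<pi>' t $ q $ l \<noteq> \<pi>' t $ q' $ l'}"
  have "finite D"
    by (rule finite_subset[of _ "{1..T} \<times> (UNIV :: ('q \<times> 'q \<times> 'q \<times> 'q) set)"]) (auto simp: D_def)
  then have "\<exists>b>0. \<forall>a\<in>D. b \<le> (case a of (t, q, l, q', l') \<Rightarrow> hellinger (\<pi>' t $ q $ l) (\<pi>' t $ q' $ l'))"
    by (rule finite_uniform_pos) (auto simp: D_def intro: hellinger_pos)
  then obtain b where b: "0 < b"
    "\<forall>a\<in>D. b \<le> (case a of (t, q, l, q', l') \<Rightarrow> hellinger (\<pi>' t $ q $ l) (\<pi>' t $ q' $ l'))"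
    by blast
  have b': "b \<le> hellinger (\<pi>' t $ q $ l) (\<pi>' t $ q' $ l')"
    if "t \<in> {1..T}" "\<pi>' t $ q $ l \<noteq> \<pi>' t $ q' $ l'" for t q l q' l'
    using bspec[OF b(2), of "(t, q, l, q', l')"] that by (simp add: D_def)
  \<comment> \<open>The perturbation factor \<open>\<tau> ^ (2 T n)\<close> then is \<open>exp (b c n / 2)\<close>, half of the gain \<open>b c n\<close>.\<close>
  define \<tau> where "\<tau> = exp (b * c / (4 * T))"
  have \<tau>: "1 < \<tau>" using b(1) c T by (simp add: \<tau>_def)
  have \<tau>_pow: "\<tau> ^ (2 * T * n) = exp (b * c / 2 * n)" for n
    using T by (simp add: \<tau>_def exp_of_nat_mult[symmetric])
  let ?\<eta> = "\<zeta> * (\<tau> - 1)"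
  define C where "C = real (card (paths T :: (nat \<Rightarrow> 'q) set)) * sqrt (1 / \<delta> ^ T)"
  define a where "a = b * c / 2"
  have a: "0 < a" using b(1) c by (simp add: a_def)
  have C: "0 \<le> C" using \<delta> by (simp add: C_def)
  define u where "u n = real n * (exp (real n * (C * exp (- (a * real n)))) - 1)" for n :: nat
  have u_nonneg: "0 \<le> u n" for n using C by (simp add: u_def)
  have bound: "measure_pmf.prob (model_pmf n T (\<Gamma>', \<pi>'))
      {\<omega>. balanced \<kappa> n T (fst \<omega>) \<and> \<not> recovers \<delta> \<zeta> ?\<eta> n T \<pi>' (fst \<omega>) (snd \<omega>)} \<le> u n"
    if n: "1 \<le> n" "2 \<le> (\<kappa> / (2 * CARD('q)))\<^sup>2 * n" for n
    unfolding model_pmf_def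
  proof (rule prob_bind_pmf_le)
    fix z assume "z \<in> set_pmf (labels_pmf n T (fst (\<Gamma>', \<pi>')))"
    then have z: "z \<in> label_set n T" using set_labels_pmf by blast
    show "measure_pmf.prob (map_pmf (Pair z) (graphs_pmf n T (snd (\<Gamma>', \<pi>')) z))
      {\<omega>. balanced \<kappa> n T (fst \<omega>) \<and> \<not> recovers \<delta> \<zeta> ?\<eta> n T \<pi>' (fst \<omega>) (snd \<omega>)} \<le> u n"
    proof (cases "balanced \<kappa> n T z")
      case True
      have "u n = real n * (exp (real n * (real (card (paths T :: (nat \<Rightarrow> 'q) set)) *
          (sqrt (1 / \<delta> ^ T) * \<tau> ^ (2 * T * n) * exp (- (b * c * n))))) - 1)"
      proof -
        have "exp (- (a * real n)) = \<tau> ^ (2 * T * n) * exp (- (b * c * n))"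
          unfolding \<tau>_pow a_def exp_add[symmetric] by (simp add: field_simps)
        then show ?thesis by (simp add: u_def C_def mult.assoc)
      qed
      with recovery_failure_prob[OF Theta' \<delta> \<zeta> less_imp_le[OF \<tau>] b(1) b' \<kappa> n z True]
      show ?thesis
        using True by (simp add: graphs_pmf_eq vimage_def c_def)
    next
      case False
      then show ?thesis using u_nonneg by (simp add: vimage_def)
    qed
  qed
  have large: "eventually (\<lambda>n. 2 \<le> (\<kappa> / (2 * CARD('q)))\<^sup>2 * real n) sequentially"
  proof -
    have "0 < (\<kappa> / (2 * CARD('q)))\<^sup>2" using \<kappa> by simp
    then show ?thesis by real_asymp
  qed
  have u_lim: "u \<longlonglongrightarrow> 0"
    unfolding u_def using a by real_asymp
  have ev: "eventually (\<lambda>n. measure_pmf.prob (model_pmf n T (\<Gamma>', \<pi>'))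
      {\<omega>. balanced \<kappa> n T (fst \<omega>) \<and> \<not> recovers \<delta> \<zeta> ?\<eta> n T \<pi>' (fst \<omega>) (snd \<omega>)} \<le> u n) sequentially"
    using eventually_ge_at_top[of 1] large by eventually_elim (rule bound)
  have "(\<lambda>n. measure_pmf.prob (model_pmf n T (\<Gamma>', \<pi>'))
      {\<omega>. balanced \<kappa> n T (fst \<omega>) \<and> \<not> recovers \<delta> \<zeta> ?\<eta> n T \<pi>' (fst \<omega>) (snd \<omega>)}) \<longlonglongrightarrow> 0"
    by (rule tendsto_sandwich[OF _ ev tendsto_const u_lim]) simp
  moreover have "0 < ?\<eta>" using \<zeta> \<tau> by simp
  ultimately show ?thesis by blast
qed

section \<open>Class sizes and transition counts of the true labels\<close>

lemma map_fst_model: "map_pmf fst (model_pmf n T \<theta>) = labels_pmf n T (fst \<theta>)"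
  by (simp add: model_pmf_def map_bind_pmf pmf.map_comp o_def bind_return_pmf')

lemma prob_model_labels:
  "measure_pmf.prob (model_pmf n T \<theta>) {\<omega>. P (fst \<omega>)} = measure_pmf.prob (labels_pmf n T (fst \<theta>)) {z. P z}"
  unfolding map_fst_model[symmetric] by (simp add: vimage_def)

lemma prob_exists_le:
  assumes "finite A" "\<And>a. a \<in> A \<Longrightarrow> measure_pmf.prob M {x. P a x} \<le> c"
  shows "measure_pmf.prob M {x. \<exists>a\<in>A. P a x} \<le> real (card A) * c"
proof -
  have "{x. \<exists>a\<in>A. P a x} = (\<Union>a\<in>A. {x. P a x})" by auto
  then have "measure_pmf.prob M {x. \<exists>a\<in>A. P a x} \<le> (\<Sum>a\<in>A. measure_pmf.prob M {x. P a x})"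
    using measure_pmf.finite_measure_subadditive_finite[OF assms(1), of "\<lambda>a. {x. P a x}" M] by simp
  also have "\<dots> \<le> (\<Sum>a\<in>A. c)" by (rule sum_mono) (rule assms(2))
  finally show ?thesis by simp
qed

lemma (in positive_chain) labels_deviation:
  assumes n: "1 \<le> n" and C: "0 < C" and a: "0 \<le> a" and f: "\<And>y. \<bar>f y\<bar> \<le> C"
  shows "measure_pmf.prob (labels_pmf n T \<Gamma>)
      {z. a \<le> \<bar>(\<Sum>i\<in>{1..n}. f (z i)) - n * measure_pmf.expectation (chain_pmf \<Gamma> T) f\<bar>}
    \<le> 2 * exp (- (a\<^sup>2 / (2 * real n * C\<^sup>2)))"
  using Pi_pmf_sum_deviation[of "{1..n}" C a "chain_pmf \<Gamma> T" f "\<lambda>_. undefined"] assms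
  by (simp add: labels_pmf_def)

lemma (in positive_chain) balanced_prob:
  assumes n: "1 \<le> n"
  shows "measure_pmf.prob (labels_pmf n T \<Gamma>) {z. \<not> balanced (\<delta> / 2) n T z}
    \<le> real (T * CARD('q)) * (2 * exp (- (\<delta>\<^sup>2 / 8 * n)))"
proof -
  have one: "measure_pmf.prob (labels_pmf n T \<Gamma>) {z. \<not> \<delta> / 2 * n \<le> card {i \<in> {1..n}. z i t = q}}
      \<le> 2 * exp (- (\<delta>\<^sup>2 / 8 * n))" if t: "t \<in> {1..T}" for t q
  proof -
    define f where "f y = (of_bool (y t = q) :: real)" for y :: "nat \<Rightarrow> 'q"
    have count: "(\<Sum>i\<in>{1..n}. f (z i)) = card {i \<in> {1..n}. z i t = q}" for z :: "'q labels"
      by (simp add: f_def of_bool_def sum.If_cases Int_def)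
    have "f = indicator {y. y t = q}" by (auto simp: f_def indicator_def)
    then have "measure_pmf.expectation (chain_pmf \<Gamma> T) f = pmf (map_pmf (\<lambda>y. y t) (chain_pmf \<Gamma> T)) q"
      by (simp add: pmf_map vimage_def)
    then have E: "\<delta> \<le> measure_pmf.expectation (chain_pmf \<Gamma> T) f"
      using state_prob_ge[OF t] by simp
    have "measure_pmf.prob (labels_pmf n T \<Gamma>) {z. \<not> \<delta> / 2 * n \<le> card {i \<in> {1..n}. z i t = q}}
        \<le> measure_pmf.prob (labels_pmf n T \<Gamma>)
          {z. \<delta> / 2 * n \<le> \<bar>(\<Sum>i\<in>{1..n}. f (z i)) - n * measure_pmf.expectation (chain_pmf \<Gamma> T) f\<bar>}"
    proof (intro measure_pmf.finite_measure_mono subsetI CollectI)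
      fix z assume "z \<in> {z. \<not> \<delta> / 2 * n \<le> card {i \<in> {1..n}. z i t = q}}"
      then have "(\<Sum>i\<in>{1..n}. f (z i)) < \<delta> / 2 * n" unfolding count by simp
      moreover have "n * \<delta> \<le> n * measure_pmf.expectation (chain_pmf \<Gamma> T) f"
        using E by (rule mult_left_mono) simp
      moreover have "\<delta> / 2 * n + \<delta> / 2 * n = n * \<delta>" by simp
      ultimately show "\<delta> / 2 * n \<le> \<bar>(\<Sum>i\<in>{1..n}. f (z i)) - n * measure_pmf.expectation (chain_pmf \<Gamma> T) f\<bar>"
        by linarith
    qed simp
    also have "\<dots> \<le> 2 * exp (- ((\<delta> / 2 * n)\<^sup>2 / (2 * real n * (1 :: real)\<^sup>2)))"
      using delta_pos by (intro labels_deviation n) (auto simp: f_def)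
    also have "(\<delta> / 2 * n)\<^sup>2 / (2 * real n * (1 :: real)\<^sup>2) = \<delta>\<^sup>2 / 8 * n"
      using n by (simp add: power2_eq_square field_simps)
    finally show ?thesis .
  qed
  have "{z. \<not> balanced (\<delta> / 2) n T z} =
      {z. \<exists>a\<in>{1..T} \<times> (UNIV :: 'q set). \<not> \<delta> / 2 * n \<le> card {i \<in> {1..n}. z i (fst a) = snd a}}"
    by (auto simp: balanced_def)
  moreover have "measure_pmf.prob (labels_pmf n T \<Gamma>)
      {z. \<exists>a\<in>{1..T} \<times> (UNIV :: 'q set). \<not> \<delta> / 2 * n \<le> card {i \<in> {1..n}. z i (fst a) = snd a}}
    \<le> real (card ({1..T} \<times> (UNIV :: 'q set))) * (2 * exp (- (\<delta>\<^sup>2 / 8 * n)))"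
  proof (rule prob_exists_le)
    fix a :: "nat \<times> 'q"
    assume "a \<in> {1..T} \<times> UNIV"
    then have "fst a \<in> {1..T}" by auto
    then show "measure_pmf.prob (labels_pmf n T \<Gamma>)
        {z. \<not> \<delta> / 2 * n \<le> card {i \<in> {1..n}. z i (fst a) = snd a}} \<le> 2 * exp (- (\<delta>\<^sup>2 / 8 * n))"
      by (rule one)
  qed simp
  ultimately show ?thesis by (simp only: card_cartesian_product card_atLeastAtMost diff_Suc_1 Suc_eq_plus1[symmetric])
qed

definition transitions :: "nat \<Rightarrow> nat \<Rightarrow> 'q labels \<Rightarrow> 'q \<Rightarrow> 'q \<Rightarrow> real" where
  "transitions n T z q l = (\<Sum>t\<in>{1..T - 1}. \<Sum>i\<in>{1..n}. of_bool (z i t = q \<and> z i (t + 1) = l))"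

definition visits :: "nat \<Rightarrow> nat \<Rightarrow> 'q labels \<Rightarrow> 'q \<Rightarrow> real" where
  "visits n T z q = (\<Sum>t\<in>{1..T - 1}. \<Sum>i\<in>{1..n}. of_bool (z i t = q))"

lemma (in positive_chain) transition_deviation:
  assumes n: "1 \<le> n" and T: "1 \<le> T" and a: "0 \<le> a"
  shows "measure_pmf.prob (labels_pmf n T \<Gamma>)
      {z. \<exists>q l. a * sqrt n \<le> \<bar>transitions n T z q l - \<Gamma> $ q $ l * visits n T z q\<bar>}
    \<le> real (CARD('q) * CARD('q)) * (2 * exp (- (a\<^sup>2 / (2 * T\<^sup>2))))"
proof -
  have one: "measure_pmf.prob (labels_pmf n T \<Gamma>)
      {z. a * sqrt n \<le> \<bar>transitions n T z q l - \<Gamma> $ q $ l * visits n T z q\<bar>}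
    \<le> 2 * exp (- (a\<^sup>2 / (2 * T\<^sup>2)))" for q l
  proof -
    define g where "g t y = of_bool (y t = q \<and> y (Suc t) = l) - \<Gamma> $ q $ l * of_bool (y t = q)"
      for t and y :: "nat \<Rightarrow> 'q"
    define f where "f y = (\<Sum>t\<in>{1..T - 1}. g t y)" for y
    have entry_le: "\<Gamma> $ q $ l \<le> 1"
    proof -
      have "\<Gamma> $ q $ l \<le> (\<Sum>l\<in>UNIV. \<Gamma> $ q $ l)"
        by (rule member_le_sum) (auto simp: entry_nonneg)
      then show ?thesis by (simp add: row_sum)
    qed
    have g: "\<bar>g t y\<bar> \<le> 1" for t y
      using entry_le entry_nonneg[of q l] by (auto simp: g_def)
    have "\<bar>f y\<bar> \<le> (\<Sum>t\<in>{1..T - 1}. 1)" for y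
      unfolding f_def by (rule order_trans[OF sum_abs]) (intro sum_mono g)
    then have f: "\<bar>f y\<bar> \<le> real T" for y
      by (rule order_trans) simp
    have int: "integrable (chain_pmf \<Gamma> T) (g t)" for t
      using g by (intro measure_pmf.integrable_const_bound[where B = 1]) auto
    have "measure_pmf.expectation (chain_pmf \<Gamma> T) f = (\<Sum>t\<in>{1..T - 1}. measure_pmf.expectation (chain_pmf \<Gamma> T) (g t))"
      unfolding f_def by (rule Bochner_Integration.integral_sum) (rule int)
    also have "\<dots> = 0"
      unfolding g_def by (intro sum.neutral ballI expectation_transition_residual) auto
    finally have E: "measure_pmf.expectation (chain_pmf \<Gamma> T) f = 0" .
    have sum_f: "transitions n T z q l - \<Gamma> $ q $ l * visits n T z q = (\<Sum>i\<in>{1..n}. f (z i))" for z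
    proof -
      have "transitions n T z q l - \<Gamma> $ q $ l * visits n T z q = (\<Sum>t\<in>{1..T - 1}. \<Sum>i\<in>{1..n}. g t (z i))"
        by (simp only: transitions_def visits_def g_def sum_distrib_left sum_subtractf Suc_eq_plus1)
      then show ?thesis unfolding f_def by (simp only: sum.swap[of _ "{1..n}"])
    qed
    have "measure_pmf.prob (labels_pmf n T \<Gamma>)
        {z. a * sqrt n \<le> \<bar>(\<Sum>i\<in>{1..n}. f (z i)) - n * measure_pmf.expectation (chain_pmf \<Gamma> T) f\<bar>}
      \<le> 2 * exp (- ((a * sqrt n)\<^sup>2 / (2 * real n * (real T)\<^sup>2)))"
      using T a f by (intro labels_deviation n) auto
    also have "(a * sqrt n)\<^sup>2 / (2 * real n * (real T)\<^sup>2) = a\<^sup>2 / (2 * T\<^sup>2)"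
      using n by (simp add: power_mult_distrib)
    finally show ?thesis by (simp add: E sum_f)
  qed
  have "{z. \<exists>q l. a * sqrt n \<le> \<bar>transitions n T z q l - \<Gamma> $ q $ l * visits n T z q\<bar>} =
    {z. \<exists>p\<in>UNIV. a * sqrt n \<le> \<bar>transitions n T z (fst p) (snd p) - \<Gamma> $ fst p $ snd p * visits n T z (fst p)\<bar>}"
    by auto
  then show ?thesis
    using prob_exists_le[of "UNIV :: ('q \<times> 'q) set" "labels_pmf n T \<Gamma>"
        "\<lambda>p z. a * sqrt n \<le> \<bar>transitions n T z (fst p) (snd p) - \<Gamma> $ fst p $ snd p * visits n T z (fst p)\<bar>",
        OF _ one]
    by simp
qed

section \<open>From label recovery to the transition matrix\<close>

text \<open>The fixed-point equation makes the estimate a ratio of posterior expectations of transition and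
  visit counts. Recovery replaces these by the true counts up to an error \<open>T\<close> each, and balanced
  classes keep the denominator of order \<open>n\<close>.\<close>

lemma fixed_point_error:
  fixes \<theta> :: "'q::finite param" and w :: "'q labels" and \<pi>' :: "nat \<Rightarrow> real^'q^'q"
  assumes rec: "recovers \<delta> \<zeta> \<eta> n T \<pi>' w x" and \<theta>: "\<theta> \<in> Theta \<delta> \<zeta> T" and \<sigma>: "bij \<sigma>"
    and close: "\<forall>t\<in>{1..T}. \<forall>q l. \<bar>snd \<theta> t $ \<sigma> q $ \<sigma> l - \<pi>' t $ q $ l\<bar> \<le> \<eta>"
    and fp: "fixed_point n T x \<theta>" and bal: "balanced \<kappa> n T w"
    and n: "1 \<le> n" and T: "2 \<le> T" and \<kappa>n: "2 * real T \<le> \<kappa> * n" and g: "0 \<le> g" "g \<le> 1"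
  shows "\<bar>fst \<theta> $ \<sigma> q $ \<sigma> l - g\<bar> \<le> (\<bar>transitions n T w q l - g * visits n T w q\<bar> + 2 * real T) / (\<kappa> * n / 2)"
proof -
  define P1 where "P1 t i = \<P>(\<omega> in model_pmf n T \<theta>. fst \<omega> i t = \<sigma> q \<and> fst \<omega> i (t + 1) = \<sigma> l \<bar> snd \<omega> = x)" for t i
  define P2 where "P2 t i = \<P>(\<omega> in model_pmf n T \<theta>. fst \<omega> i t = \<sigma> q \<bar> snd \<omega> = x)" for t i
  define A1 where "A1 = (\<Sum>t\<in>{1..T - 1}. \<Sum>i\<in>{1..n}. P1 t i)"
  define A2 where "A2 = (\<Sum>t\<in>{1..T - 1}. \<Sum>i\<in>{1..n}. P2 t i)"
  have eq: "fst \<theta> $ \<sigma> q $ \<sigma> l = A1 / A2"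
    using fp unfolding fixed_point_def A1_def A2_def P1_def P2_def by blast
  have post: "\<bar>\<P>(\<omega> in model_pmf n T \<theta>. A (fst \<omega>) \<bar> snd \<omega> = x) - of_bool (A (relabel n T \<sigma> w))\<bar> \<le> 1 / real n"
    for A
    using rec \<theta> \<sigma> close unfolding recovers_def by blast
  have inj: "\<sigma> a = \<sigma> b \<longleftrightarrow> a = b" for a b
    using \<sigma> by (simp add: bij_def inj_eq)
  have dev: "\<bar>(\<Sum>t\<in>{1..T - 1}. \<Sum>i\<in>{1..n}. f t i) - (\<Sum>t\<in>{1..T - 1}. \<Sum>i\<in>{1..n}. h t i)\<bar> \<le> T"
    if "\<And>t i. t \<in> {1..T - 1} \<Longrightarrow> i \<in> {1..n} \<Longrightarrow> \<bar>f t i - h t i\<bar> \<le> 1 / real n"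
    for f h :: "nat \<Rightarrow> nat \<Rightarrow> real"
  proof -
    have "\<bar>(\<Sum>t\<in>{1..T - 1}. \<Sum>i\<in>{1..n}. f t i) - (\<Sum>t\<in>{1..T - 1}. \<Sum>i\<in>{1..n}. h t i)\<bar>
        = \<bar>\<Sum>t\<in>{1..T - 1}. \<Sum>i\<in>{1..n}. f t i - h t i\<bar>"
      by (simp add: sum_subtractf)
    also have "\<dots> \<le> (\<Sum>t\<in>{1..T - 1}. \<Sum>i\<in>{1..n}. \<bar>f t i - h t i\<bar>)"
      by (rule order_trans[OF sum_abs]) (intro sum_mono sum_abs)
    also have "\<dots> \<le> (\<Sum>t\<in>{1..T - 1}. \<Sum>i\<in>{1..n}. 1 / real n)"
      by (intro sum_mono that)
    also have "\<dots> \<le> T" using n by simp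
    finally show ?thesis .
  qed
  have d1: "\<bar>A1 - transitions n T w q l\<bar> \<le> T"
    unfolding A1_def transitions_def
  proof (rule dev)
    fix t i assume t: "t \<in> {1..T - 1}" and i: "i \<in> {1..n}"
    then have "t \<in> {1..T}" "t + 1 \<in> {1..T}" by auto
    then have "relabel n T \<sigma> w i t = \<sigma> (w i t)" "relabel n T \<sigma> w i (t + 1) = \<sigma> (w i (t + 1))"
      using i by (simp_all add: relabel_def)
    with post[of "\<lambda>z. z i t = \<sigma> q \<and> z i (t + 1) = \<sigma> l"]
    show "\<bar>P1 t i - of_bool (w i t = q \<and> w i (t + 1) = l)\<bar> \<le> 1 / real n"
      unfolding P1_def by (simp only: inj)
  qed
  have d2: "\<bar>A2 - visits n T w q\<bar> \<le> T"
    unfolding A2_def visits_def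
  proof (rule dev)
    fix t i assume t: "t \<in> {1..T - 1}" and i: "i \<in> {1..n}"
    then have "t \<in> {1..T}" by auto
    then have "relabel n T \<sigma> w i t = \<sigma> (w i t)"
      using i by (simp add: relabel_def)
    with post[of "\<lambda>z. z i t = \<sigma> q"]
    show "\<bar>P2 t i - of_bool (w i t = q)\<bar> \<le> 1 / real n"
      unfolding P2_def by (simp only: inj)
  qed
  \<comment> \<open>The first time alone provides enough visits.\<close>
  have "\<kappa> * n \<le> visits n T w q"
  proof -
    have "\<kappa> * n \<le> card {i \<in> {1..n}. w i 1 = q}"
      using bal T by (simp add: balanced_def)
    also have "\<dots> = (\<Sum>i\<in>{1..n}. of_bool (w i 1 = q))"
      by (simp add: of_bool_def sum.If_cases Int_def)
    also have "\<dots> \<le> visits n T w q"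
      unfolding visits_def
      using T by (intro member_le_sum[where f = "\<lambda>t. \<Sum>i\<in>{1..n}. of_bool (w i t = q)"])
        (auto intro: sum_nonneg)
    finally show ?thesis .
  qed
  then have A2: "\<kappa> * n / 2 \<le> A2" using d2 \<kappa>n by linarith
  have pos: "0 < \<kappa> * n / 2" using \<kappa>n T by linarith
  have "\<bar>g * (A2 - visits n T w q)\<bar> \<le> 1 * real T"
    unfolding abs_mult using g d2 by (intro mult_mono) auto
  moreover have "A1 - g * A2 = (A1 - transitions n T w q l)
      + (transitions n T w q l - g * visits n T w q) - g * (A2 - visits n T w q)"
    by (simp add: algebra_simps)
  ultimately have num: "\<bar>A1 - g * A2\<bar> \<le> \<bar>transitions n T w q l - g * visits n T w q\<bar> + 2 * real T"
    using d1 by linarith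
  have "\<bar>fst \<theta> $ \<sigma> q $ \<sigma> l - g\<bar> = \<bar>A1 - g * A2\<bar> / A2"
  proof -
    have "0 < A2" using A2 pos by linarith
    then have "A1 / A2 - g = (A1 - g * A2) / A2" by (simp add: diff_divide_distrib)
    then show ?thesis using \<open>0 < A2\<close> by (simp add: eq abs_divide)
  qed
  also have "\<dots> \<le> (\<bar>transitions n T w q l - g * visits n T w q\<bar> + 2 * real T) / (\<kappa> * n / 2)"
    using num A2 pos by (intro frac_le) auto
  finally show ?thesis .
qed

text \<open>Whichever way the estimator was produced, it lies in the parameter set and satisfies the
  fixed-point equation.\<close>

lemma is_mle_fixed_point:
  assumes "is_mle \<delta> \<zeta> n T x \<theta>"
  shows "\<theta> \<in> Theta \<delta> \<zeta> T" "fixed_point n T x \<theta>"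
proof -
  obtain \<Gamma>\<^sub>0 where m: "is_arg_max (log_likelihood n T x) (\<lambda>\<theta>'. \<theta>' \<in> Theta \<delta> \<zeta> T) (\<Gamma>\<^sub>0, snd \<theta>)"
    and c: "if fixed_point n T x (\<Gamma>\<^sub>0, snd \<theta>) then fst \<theta> = \<Gamma>\<^sub>0
      else \<theta> \<in> Theta \<delta> \<zeta> T \<and> fixed_point n T x \<theta>"
    using assms unfolding is_mle_def by blast
  have "(\<Gamma>\<^sub>0, snd \<theta>) \<in> Theta \<delta> \<zeta> T" using m unfolding is_arg_max_def by blast
  moreover have "\<theta> = (\<Gamma>\<^sub>0, snd \<theta>)" if "fst \<theta> = \<Gamma>\<^sub>0" using that by (metis prod.collapse)
  ultimately have "\<theta> \<in> Theta \<delta> \<zeta> T \<and> fixed_point n T x \<theta>"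
    using c by (cases "fixed_point n T x (\<Gamma>\<^sub>0, snd \<theta>)") auto
  then show "\<theta> \<in> Theta \<delta> \<zeta> T" "fixed_point n T x \<theta>" by blast+
qed

lemma dist_pi_le_iff:
  assumes "1 \<le> T"
  shows "dist_pi T \<pi> \<pi>' \<le> c \<longleftrightarrow> (\<forall>t\<in>{1..T}. \<forall>q l. \<bar>\<pi> t $ q $ l - \<pi>' t $ q $ l\<bar> \<le> c)"
  unfolding dist_pi_def using assms by (subst Max_le_iff) auto

lemma dist_Gamma_le_iff:
  "dist_Gamma \<Gamma> \<Gamma>' \<le> c \<longleftrightarrow> (\<forall>q l. \<bar>\<Gamma> $ q $ l - \<Gamma>' $ q $ l\<bar> \<le> c)"
  unfolding dist_Gamma_def by (subst Max_le_iff) auto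

text \<open>The deterministic core: the permutation that aligns \<open>\<pi>\<close> also aligns \<open>\<Gamma>\<close>.\<close>

lemma estimation_error:
  fixes \<theta> :: "'q::finite param"
  assumes chain: "positive_chain \<Gamma>' \<delta>"
    and mle: "is_mle \<delta> \<zeta> n T x \<theta>"
    and \<pi>_close: "(MIN \<sigma>\<in>{\<sigma>. \<sigma> permutes (UNIV :: 'q set)}.
        dist_pi T (\<lambda>t. permute_mat \<sigma> (snd \<theta> t)) \<pi>') \<le> \<eta>"
    and rec: "recovers \<delta> \<zeta> \<eta> n T \<pi>' w x" and bal: "balanced \<kappa> n T w"
    and trans: "\<And>q l. \<bar>transitions n T w q l - \<Gamma>' $ q $ l * visits n T w q\<bar> \<le> a"
    and n: "1 \<le> n" and T: "2 \<le> T" and \<kappa>n: "2 * real T \<le> \<kappa> * n"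
  shows "(MIN \<sigma>\<in>{\<sigma>. \<sigma> permutes (UNIV :: 'q set)}. dist_Gamma (permute_mat \<sigma> (fst \<theta>)) \<Gamma>')
    \<le> (a + 2 * real T) / (\<kappa> * n / 2)"
proof -
  interpret positive_chain \<Gamma>' \<delta> by (rule chain)
  let ?S = "{\<sigma>. \<sigma> permutes (UNIV :: 'q set)}"
  have finS: "finite ?S" by (rule finite_permutations) simp
  have neS: "?S \<noteq> {}" using permutes_id by blast
  have "\<exists>\<sigma>\<in>?S. dist_pi T (\<lambda>t. permute_mat \<sigma> (snd \<theta> t)) \<pi>' \<le> \<eta>"
    using \<pi>_close finS neS by (subst (asm) Min_le_iff) auto
  then obtain \<sigma> where \<sigma>: "\<sigma> permutes UNIV"
    and "dist_pi T (\<lambda>t. permute_mat \<sigma> (snd \<theta> t)) \<pi>' \<le> \<eta>" by blast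
  then have close: "\<forall>t\<in>{1..T}. \<forall>q l. \<bar>snd \<theta> t $ \<sigma> q $ \<sigma> l - \<pi>' t $ q $ l\<bar> \<le> \<eta>"
    using T by (simp add: dist_pi_le_iff permute_mat_def)
  have "\<bar>permute_mat \<sigma> (fst \<theta>) $ q $ l - \<Gamma>' $ q $ l\<bar> \<le> (a + 2 * real T) / (\<kappa> * n / 2)" for q l
  proof -
    have "\<Gamma>' $ q $ l \<le> (\<Sum>l\<in>UNIV. \<Gamma>' $ q $ l)"
      by (rule member_le_sum) (auto simp: entry_nonneg)
    then have "\<Gamma>' $ q $ l \<le> 1" by (simp add: row_sum)
    then have "\<bar>fst \<theta> $ \<sigma> q $ \<sigma> l - \<Gamma>' $ q $ l\<bar>
        \<le> (\<bar>transitions n T w q l - \<Gamma>' $ q $ l * visits n T w q\<bar> + 2 * real T) / (\<kappa> * n / 2)"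
      by (intro fixed_point_error[OF rec is_mle_fixed_point(1)[OF mle] permutes_bij[OF \<sigma>] close
            is_mle_fixed_point(2)[OF mle] bal n T \<kappa>n] entry_nonneg)
    also have "\<dots> \<le> (a + 2 * real T) / (\<kappa> * n / 2)"
      using trans[of q l] \<kappa>n T by (intro divide_right_mono) linarith+
    finally show ?thesis by (simp add: permute_mat_def)
  qed
  then have "dist_Gamma (permute_mat \<sigma> (fst \<theta>)) \<Gamma>' \<le> (a + 2 * real T) / (\<kappa> * n / 2)"
    unfolding dist_Gamma_le_iff by blast
  then show ?thesis
    using \<sigma> finS neS by (subst Min_le_iff) auto
qed

lemma prob_Un_le:
  "measure_pmf.prob M {x. P x \<or> Q x} \<le> measure_pmf.prob M {x. P x} + measure_pmf.prob M {x. Q x}"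
  using measure_Un_le[of "{x. P x}" M "{x. Q x}"] by (simp add: Un_def)

theorem corollary4:
  fixes \<delta> \<zeta> :: real and T :: nat
    and \<theta>_true :: "'q::finite param"
    and \<theta>_hat :: "nat \<Rightarrow> graphs \<Rightarrow> 'q param"
    and v :: "nat \<Rightarrow> real"
  assumes "CARD('q) \<ge> 2"
    and "0 < \<delta>" "\<delta> < 1 / real CARD('q)"
    and "0 < \<zeta>" "\<zeta> < 1 / 2"
    and "T \<ge> 2"
    and "\<theta>_true \<in> Theta \<delta> \<zeta> T"
    and mle: "(\<lambda>n. \<P>(\<omega> in model_pmf n T \<theta>_true. is_mle \<delta> \<zeta> n T (snd \<omega>) (\<theta>_hat n (snd \<omega>))))
                \<longlonglongrightarrow> 1"
    and "\<forall>n\<ge>1. v n > 0" "v \<longlonglongrightarrow> 0"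
    and "v \<in> o(\<lambda>n. sqrt (ln (real n)) / real n)"
    and "small_o_prob (\<lambda>n. measure_pmf (model_pmf n T \<theta>_true))
           (\<lambda>n \<omega>. MIN \<sigma>\<in>{\<sigma>. \<sigma> permutes (UNIV :: 'q set)}.
              dist_pi T (\<lambda>t. permute_mat \<sigma> (snd (\<theta>_hat n (snd \<omega>)) t)) (snd \<theta>_true)) v"
  shows "\<forall>\<epsilon>>0. \<forall>r :: nat \<Rightarrow> real.
           (\<forall>n\<ge>1. r n > 0) \<longrightarrow> filterlim r at_top sequentially \<longrightarrow>
           r \<in> o(\<lambda>n. sqrt (real n / ln (real n))) \<longrightarrow>
           (\<lambda>n. \<P>(\<omega> in model_pmf n T \<theta>_true.
              (MIN \<sigma>\<in>{\<sigma>. \<sigma> permutes (UNIV :: 'q set)}.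
                 dist_Gamma (permute_mat \<sigma> (fst (\<theta>_hat n (snd \<omega>)))) (fst \<theta>_true))
              > \<epsilon> * r n * (sqrt (ln (real n)) / sqrt (real n)))) \<longlonglongrightarrow> 0"
proof (intro allI impI)
  fix \<epsilon> :: real and r :: "nat \<Rightarrow> real"
  assume \<epsilon>: "0 < \<epsilon>" and r: "filterlim r at_top sequentially"
  note \<delta>_pos = \<open>0 < \<delta>\<close> and \<zeta>_pos = \<open>0 < \<zeta>\<close> and T = \<open>T \<ge> 2\<close>
  obtain \<Gamma>' \<pi>' where \<theta>_eq: "\<theta>_true = (\<Gamma>', \<pi>')" by (cases \<theta>_true)
  have Theta': "(\<Gamma>', \<pi>') \<in> Theta \<delta> \<zeta> T" using \<open>\<theta>_true \<in> Theta \<delta> \<zeta> T\<close> by (simp add: \<theta>_eq)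
  have \<delta>_le: "\<delta> \<le> 1"
  proof -
    have "1 / real CARD('q) \<le> 1" using \<open>CARD('q) \<ge> 2\<close> by simp
    then show ?thesis using \<open>\<delta> < 1 / real CARD('q)\<close> by linarith
  qed
  interpret positive_chain \<Gamma>' \<delta> by (rule positive_chain_Theta[OF Theta' \<delta>_pos])
  define \<kappa> where "\<kappa> = \<delta> / 2"
  have \<kappa>: "0 < \<kappa>" "\<kappa> \<le> 1" using \<delta>_pos \<delta>_le by (simp_all add: \<kappa>_def)
  let ?P = "\<lambda>n. measure_pmf.prob (model_pmf n T \<theta>_true)"
  obtain \<eta> where \<eta>: "0 < \<eta>"
    and rec_lim: "(\<lambda>n. ?P n {\<omega>. balanced \<kappa> n T (fst \<omega>) \<and> \<not> recovers \<delta> \<zeta> \<eta> n T \<pi>' (fst \<omega>) (snd \<omega>)}) \<longlonglongrightarrow> 0"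
    using posterior_concentration[OF Theta' \<delta>_pos \<delta>_le \<zeta>_pos _ \<kappa>] T unfolding \<theta>_eq by auto
  \<comment> \<open>Transition counts fluctuate by \<open>\<surd>n\<close>, so a deviation \<open>a n * \<surd>n\<close> is unlikely once \<open>a\<close> tends to
    infinity. The constant makes the resulting error bound equal to the claimed rate: a numerator of at
    most \<open>2 * a n * \<surd>n\<close> over \<open>\<kappa> * n / 2\<close>.\<close>
  define a where "a n = \<kappa> * \<epsilon> / 4 * (r n * sqrt (ln (real n)))" for n
  have a_lim: "filterlim a at_top sequentially"
  proof -
    have "filterlim (\<lambda>n. sqrt (ln (real n))) at_top sequentially" by real_asymp
    then have "filterlim (\<lambda>n. r n * sqrt (ln (real n))) at_top sequentially"
      by (rule filterlim_at_top_mult_at_top[OF r])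
    then show ?thesis
      unfolding a_def using \<kappa> \<epsilon>
      by (intro filterlim_tendsto_pos_mult_at_top[OF tendsto_const]) auto
  qed
  define d where "d n \<omega> = (MIN \<sigma>\<in>{\<sigma>. \<sigma> permutes (UNIV :: 'q set)}.
      dist_pi T (\<lambda>t. permute_mat \<sigma> (snd (\<theta>_hat n (snd \<omega>)) t)) \<pi>')"
    for n and \<omega> :: "'q labels \<times> graphs"
  \<comment> \<open>Outside these five unlikely events the estimation error is controlled deterministically.\<close>
  let ?E1 = "\<lambda>n \<omega>. \<not> is_mle \<delta> \<zeta> n T (snd \<omega>) (\<theta>_hat n (snd \<omega>))"
  let ?E2 = "\<lambda>n \<omega>. \<bar>d n \<omega> / v n\<bar> > 1"
  let ?E3 = "\<lambda>n \<omega>. balanced \<kappa> n T (fst \<omega>) \<and> \<not> recovers \<delta> \<zeta> \<eta> n T \<pi>' (fst \<omega>) (snd \<omega>)"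
  let ?E4 = "\<lambda>n (\<omega> :: 'q labels \<times> graphs). \<not> balanced \<kappa> n T (fst \<omega>)"
  let ?E5 = "\<lambda>n (\<omega> :: 'q labels \<times> graphs). \<exists>q l. a n * sqrt n \<le>
    \<bar>transitions n T (fst \<omega>) q l - \<Gamma>' $ q $ l * visits n T (fst \<omega>) q\<bar>"
  have lim1: "(\<lambda>n. ?P n {\<omega>. ?E1 n \<omega>}) \<longlonglongrightarrow> 0"
  proof -
    have "?P n {\<omega>. ?E1 n \<omega>} = 1 - \<P>(\<omega> in model_pmf n T \<theta>_true. is_mle \<delta> \<zeta> n T (snd \<omega>) (\<theta>_hat n (snd \<omega>)))"
      for n
      using measure_pmf.prob_neg[of "model_pmf n T \<theta>_true" "\<lambda>\<omega>. is_mle \<delta> \<zeta> n T (snd \<omega>) (\<theta>_hat n (snd \<omega>))"]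
      by simp
    then show ?thesis using tendsto_diff[OF tendsto_const mle, of 1] by simp
  qed
  have lim2: "(\<lambda>n. ?P n {\<omega>. ?E2 n \<omega>}) \<longlonglongrightarrow> 0"
    using assms(12)[unfolded small_o_prob_def, rule_format, of 1] by (simp add: d_def \<theta>_eq)
  have lim4: "(\<lambda>n. ?P n {\<omega>. ?E4 n \<omega>}) \<longlonglongrightarrow> 0"
  proof (rule tendsto_sandwich[OF _ _ tendsto_const])
    show "\<forall>\<^sub>F n in sequentially. ?P n {\<omega>. ?E4 n \<omega>} \<le> real (T * CARD('q)) * (2 * exp (- (\<delta>\<^sup>2 / 8 * n)))"
      using eventually_ge_at_top[of 1]
    proof eventually_elim
      case (elim n)
      show ?case
        using balanced_prob[OF elim] unfolding prob_model_labels[where P = "\<lambda>z. \<not> balanced \<kappa> n T z"]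
        by (simp add: \<theta>_eq \<kappa>_def)
    qed
    have "0 < \<delta>\<^sup>2 / 8" using \<delta>_pos by simp
    then show "(\<lambda>n. real (T * CARD('q)) * (2 * exp (- (\<delta>\<^sup>2 / 8 * real n)))) \<longlonglongrightarrow> 0" by real_asymp
  qed simp
  have lim5: "(\<lambda>n. ?P n {\<omega>. ?E5 n \<omega>}) \<longlonglongrightarrow> 0"
  proof (rule tendsto_sandwich[OF _ _ tendsto_const])
    show "\<forall>\<^sub>F n in sequentially. ?P n {\<omega>. ?E5 n \<omega>}
        \<le> real (CARD('q) * CARD('q)) * (2 * exp (- ((a n)\<^sup>2 / (2 * T\<^sup>2))))"
      using eventually_ge_at_top[of 1] filterlim_at_top[THEN iffD1, OF a_lim, rule_format, of 0]
    proof eventually_elim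
      case (elim n)
      show ?case
        using transition_deviation[OF elim(1) _ elim(2), of T] T
        unfolding prob_model_labels[where P = "\<lambda>z. \<exists>q l. a n * sqrt n \<le>
          \<bar>transitions n T z q l - \<Gamma>' $ q $ l * visits n T z q\<bar>"]
        by (simp add: \<theta>_eq)
    qed
    have "((\<lambda>y. real (CARD('q) * CARD('q)) * (2 * exp (- (y\<^sup>2 / (2 * (real T)\<^sup>2))))) \<longlongrightarrow> 0) at_top"
    proof -
      have "0 < 2 * (real T)\<^sup>2" using T by simp
      then show ?thesis by real_asymp
    qed
    from filterlim_compose[OF this a_lim]
    show "(\<lambda>n. real (CARD('q) * CARD('q)) * (2 * exp (- ((a n)\<^sup>2 / (2 * T\<^sup>2))))) \<longlonglongrightarrow> 0" by simp
  qed simp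
  let ?bad = "\<lambda>n \<omega>. (MIN \<sigma>\<in>{\<sigma>. \<sigma> permutes (UNIV :: 'q set)}.
      dist_Gamma (permute_mat \<sigma> (fst (\<theta>_hat n (snd \<omega>)))) (fst \<theta>_true))
    > \<epsilon> * r n * (sqrt (ln (real n)) / sqrt (real n))"
  show "(\<lambda>n. \<P>(\<omega> in model_pmf n T \<theta>_true. ?bad n \<omega>)) \<longlonglongrightarrow> 0"
  proof (rule tendsto_sandwich[OF _ _ tendsto_const])
    let ?u = "\<lambda>n. ?P n {\<omega>. ?E1 n \<omega>} + (?P n {\<omega>. ?E2 n \<omega>} + (?P n {\<omega>. ?E3 n \<omega>} +
      (?P n {\<omega>. ?E4 n \<omega>} + ?P n {\<omega>. ?E5 n \<omega>})))"
    show "?u \<longlonglongrightarrow> 0"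
      using tendsto_add[OF lim1 tendsto_add[OF lim2 tendsto_add[OF rec_lim tendsto_add[OF lim4 lim5]]]] by simp
    have "\<forall>\<^sub>F n in sequentially. v n < \<eta>"
      using order_tendstoD(2)[OF \<open>v \<longlonglongrightarrow> 0\<close> \<eta>] .
    moreover have "\<forall>\<^sub>F n in sequentially. 2 * real T \<le> \<kappa> * real n"
      using \<kappa>(1) by real_asymp
    moreover have "\<forall>\<^sub>F n in sequentially. 2 * real T \<le> a n"
      using a_lim by (simp add: filterlim_at_top)
    ultimately show "\<forall>\<^sub>F n in sequentially. \<P>(\<omega> in model_pmf n T \<theta>_true. ?bad n \<omega>) \<le> ?u n"
      using eventually_ge_at_top[of 1]
    proof eventually_elim
      case (elim n)
      have n: "1 \<le> n" and v: "0 < v n" using elim(4) assms(9) by auto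
      have "?E1 n \<omega> \<or> ?E2 n \<omega> \<or> ?E3 n \<omega> \<or> ?E4 n \<omega> \<or> ?E5 n \<omega>" if bad: "?bad n \<omega>" for \<omega>
      proof (rule ccontr)
        assume good: "\<not> ?thesis"
        have "d n \<omega> \<le> \<eta>"
          using good v elim(1) by (auto simp: abs_le_iff pos_divide_le_eq not_less)
        moreover have "\<bar>transitions n T (fst \<omega>) q l - \<Gamma>' $ q $ l * visits n T (fst \<omega>) q\<bar> \<le> a n * sqrt n" for q l
          using good by (meson linear)
        ultimately have "(MIN \<sigma>\<in>{\<sigma>. \<sigma> permutes (UNIV :: 'q set)}.
            dist_Gamma (permute_mat \<sigma> (fst (\<theta>_hat n (snd \<omega>)))) \<Gamma>')
          \<le> (a n * sqrt n + 2 * real T) / (\<kappa> * n / 2)"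
          using good unfolding d_def
          by (intro estimation_error[OF positive_chain_axioms _ _ _ _ _ n T elim(2)]) blast+
        also have "\<dots> \<le> (a n * sqrt n + a n * sqrt n) / (\<kappa> * n / 2)"
        proof (intro divide_right_mono add_left_mono)
          have "a n * 1 \<le> a n * sqrt n" using elim(3) n by (intro mult_left_mono) auto
          then show "2 * real T \<le> a n * sqrt n" using elim(3) by simp
        qed (use \<kappa> in simp)
        also have "\<dots> = \<epsilon> * r n * (sqrt (ln (real n)) / sqrt (real n))"
        proof -
          have "real n = sqrt n * sqrt n" by simp
          then show ?thesis using \<kappa> n unfolding a_def by (simp add: field_simps)
        qed
        finally show False using bad by (simp add: \<theta>_eq)
      qed
      then have "\<P>(\<omega> in model_pmf n T \<theta>_true. ?bad n \<omega>)
          \<le> ?P n {\<omega>. ?E1 n \<omega> \<or> ?E2 n \<omega> \<or> ?E3 n \<omega> \<or> ?E4 n \<omega> \<or> ?E5 n \<omega>}"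
        by (intro measure_pmf.finite_measure_mono) auto
      also have "\<dots> \<le> ?u n"
        by (intro order_trans[OF prob_Un_le] add_left_mono order_refl)
      finally show ?case .
    qed
  qed simp
qed

end
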